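(* Let $s_0=\sigma_0+it_0\in\mathbb{C}$, $s=\sigma+it\in\mathbb{C}\setminus\{1\}$, $x\ge1$ and $C>1$. Suppose $\sigma>\max(0,2-\sigma_0)$ and $|t|\le 2\pi x/C$. Then, as $x\to\infty$, $$\zeta_2(s_0,s)=\sum_{m=1}^\infty\sum_{1\le n\le x}\frac{1}{m^{s_0}(m+n)^s}-\frac{1}{1-s}\sum_{m=1}^\infty\frac{1}{m^{s_0}(m+x)^{s-1}}+\begin{cases}O(x^{-\sigma}) & (\sigma_0>1),\\ O(x^{-\sigma}\log x) & (\sigma_0=1),\\ O(x^{1-\sigma-\sigma_0}) & (\sigma_0<1).\end{cases}$$
   Context: The Euler double zeta-function is $\zeta_2(s_1,s_2)=\sum_{m=1}^\infty m^{-s_1}\sum_{n=1}^\infty (m+n)^{-s_2}$, absolutely convergent for $\Re s_2>1$, $\Re(s_1+s_2)>2$, and continued meromorphically to $\mathbb{C}^2$ (singularities on $s_2=1$ and $s_1+s_2=2,1,0,-2,-4,\dots$). Complex powers use principal branches. *)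

theory Defs
  imports "HOL-Complex_Analysis.Complex_Analysis"
begin

text \<open>
  Holomorphy of a function of two complex variables on an open set \<open>D\<close>, as continuity together
  with holomorphy in each variable separately.
\<close>

definition holomorphic2_on :: "(complex \<times> complex \<Rightarrow> complex) \<Rightarrow> (complex \<times> complex) set \<Rightarrow> bool" where
  "holomorphic2_on F D \<longleftrightarrow>
     continuous_on D F \<and>
     (\<forall>b. (\<lambda>z. F (z, b)) holomorphic_on {z. (z, b) \<in> D}) \<and>
     (\<forall>a. (\<lambda>w. F (a, w)) holomorphic_on {w. (a, w) \<in> D})"

definition zeta2_series :: "complex \<Rightarrow> complex \<Rightarrow> complex" where
  "zeta2_series s1 s2 =
     (\<Sum>m. of_nat (Suc m) powr (- s1) * (\<Sum>n. of_nat (Suc m + Suc n) powr (- s2)))"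

definition zeta2_conv :: "(complex \<times> complex) set" where
  "zeta2_conv = {(s1, s2). Re s2 > 1 \<and> Re (s1 + s2) > 2}"

definition zeta2_sing :: "(complex \<times> complex) set" where
  "zeta2_sing = {(s1, s2). s2 = 1 \<or> s1 + s2 \<in> {2, 1} \<union> range (\<lambda>k::nat. - 2 * of_nat k)}"

definition zeta2_continuation ::
    "(complex \<times> complex) set \<Rightarrow> (complex \<times> complex \<Rightarrow> complex) \<Rightarrow> bool" where
  "zeta2_continuation U F \<longleftrightarrow>
     open U \<and> convex U \<and> zeta2_conv \<subseteq> U \<and> holomorphic2_on F (U - zeta2_sing) \<and>
     (\<forall>s1 s2. (s1, s2) \<in> zeta2_conv \<longrightarrow> F (s1, s2) = zeta2_series s1 s2)"

text \<open>
  The value at a point off the singular hyperplanes of the continued double zeta function.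
  The choice of \<open>U\<close> and \<open>F\<close> does not matter, see \<open>euler_zeta2_eq\<close> below; in particular, with
  \<open>U = UNIV\<close>, \<open>euler_zeta2\<close> agrees off the singular hyperplanes with the meromorphic continuation
  of the series to the whole of \<open>\<complex>\<^sup>2\<close>. Its values on the singular hyperplanes are unspecified.
\<close>

definition euler_zeta2 :: "complex \<Rightarrow> complex \<Rightarrow> complex" where
  "euler_zeta2 s1 s2 =
     (THE w. \<exists>U F. zeta2_continuation U F \<and> (s1, s2) \<in> U - zeta2_sing \<and> w = F (s1, s2))"

lemma zeta2_continuation_unique:
  assumes F: "zeta2_continuation U F" and G: "zeta2_continuation V G"
    and p: "(s1, s2) \<in> U - zeta2_sing" "(s1, s2) \<in> V - zeta2_sing"
  shows "F (s1, s2) = G (s1, s2)"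
proof -
  define X where "X = {1} \<union> (\<lambda>z. z - s1) ` ({2, 1} \<union> range (\<lambda>k::nat. - 2 * of_nat k :: complex))"
  have X: "(s1, w) \<in> zeta2_sing \<longleftrightarrow> w \<in> X" for w
    unfolding zeta2_sing_def X_def by (force simp: algebra_simps image_iff)
  have "closed ({2, 1} \<union> range (\<lambda>k::nat. - 2 * of_nat k :: complex))"
    by (rule closed_subset_Ints) auto
  then have clX: "closed X"
    unfolding X_def by (rule closed_Un[OF closed_singleton closed_translation_subtract])
  have cX: "countable X"
    unfolding X_def by auto
  define T where "T = {w. (s1, w) \<in> U \<inter> V}"
  have T: "T = (\<lambda>w. (s1, w)) -` (U \<inter> V)"
    by (auto simp: T_def)
  have "open T"
    unfolding T using F G
    by (intro open_vimage open_Int continuous_intros) (auto simp: zeta2_continuation_def)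
  have "convex T"
  proof (rule convexI)
    fix x y u v assume h: "x \<in> T" "y \<in> T" "0 \<le> u" "0 \<le> v" "u + v = (1::real)"
    have "convex (U \<inter> V)"
      using F G by (auto simp: zeta2_continuation_def intro: convex_Int)
    then have "u *\<^sub>R (s1, x) + v *\<^sub>R (s1, y) \<in> U \<inter> V"
      using h by (intro convexD) (auto simp: T_def)
    moreover have "u *\<^sub>R (s1, x) + v *\<^sub>R (s1, y) = (s1, u *\<^sub>R x + v *\<^sub>R y)"
      using h by (simp flip: scaleR_add_left)
    ultimately show "u *\<^sub>R x + v *\<^sub>R y \<in> T" by (simp add: T_def)
  qed
  have conn: "connected (T - X)"
    using connected_open_diff_countable[OF _ \<open>open T\<close> convex_connected[OF \<open>convex T\<close>] cX] by simp
  define H where "H = {w. Re w > max 1 (2 - Re s1)}"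
  have H: "w \<in> H \<Longrightarrow> (s1, w) \<in> zeta2_conv" for w
    by (auto simp: H_def zeta2_conv_def)
  have "zeta2_conv \<inter> zeta2_sing = {}"
    by (auto simp: zeta2_conv_def zeta2_sing_def complex_eq_iff)
  then have HT: "H \<subseteq> T - X"
    using F G H unfolding T_def zeta2_continuation_def by (blast intro: X[THEN iffD2])
  have "open H"
    unfolding H_def by (rule open_halfspace_Re_gt)
  have "of_real (max 1 (2 - Re s1) + 1) \<in> H"
    unfolding H_def mem_Collect_eq Re_complex_of_real by linarith
  then have "H \<noteq> {}" by blast
  have hol: "(\<lambda>w. F (s1, w)) holomorphic_on T - X" "(\<lambda>w. G (s1, w)) holomorphic_on T - X"
  proof -
    have "(\<lambda>w. F (s1, w)) holomorphic_on {w. (s1, w) \<in> U - zeta2_sing}"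
         "(\<lambda>w. G (s1, w)) holomorphic_on {w. (s1, w) \<in> V - zeta2_sing}"
      using F G by (auto simp: zeta2_continuation_def holomorphic2_on_def)
    then show "(\<lambda>w. F (s1, w)) holomorphic_on T - X" "(\<lambda>w. G (s1, w)) holomorphic_on T - X"
      by (auto simp: T_def X elim!: holomorphic_on_subset)
  qed
  show ?thesis
  proof (rule analytic_continuation_open[OF \<open>open H\<close> _ \<open>H \<noteq> {}\<close> conn HT hol, of s2])
    show "open (T - X)" using \<open>open T\<close> clX by blast
    show "F (s1, w) = G (s1, w)" if "w \<in> H" for w
      using F G H[OF that] by (auto simp: zeta2_continuation_def)
    show "s2 \<in> T - X" using p by (auto simp: T_def simp flip: X)
  qed
qed

lemma euler_zeta2_eq:
  assumes "zeta2_continuation U F" "(s1, s2) \<in> U - zeta2_sing"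
  shows "euler_zeta2 s1 s2 = F (s1, s2)"
  unfolding euler_zeta2_def
  by (rule the_equality) (use assms zeta2_continuation_unique in blast)+

end

theory Submission
  imports Defs
begin

text \<open>
  For a fixed \<open>m\<close> the inner sum is a tail of the Riemann zeta series, continued to \<open>Re s > 0\<close> by
  subtracting the integral of \<open>u powr (- s)\<close> over \<open>[k, k + 1]\<close> from each term. Summing these tails
  against \<open>m powr (- s\<^sub>0)\<close> continues the double zeta function to \<open>Re s > 0\<close>, \<open>Re (s\<^sub>0 + s) > 2\<close>.
  The error of truncating the tail at \<open>y = m + x\<close> is \<open>O(y powr (- \<sigma>))\<close>, uniformly for \<open>\<bar>t\<bar> \<le> 2 \<pi> y / C\<close>:
  with \<open>z = - \<i> t / k\<close> and \<open>h z = 1 / (exp z - 1) - 1 / z\<close>, the difference between the term and the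
  integral at \<open>k\<close> equals the increment of \<open>k powr (- s) * h z\<close> up to \<open>O(k powr (- \<sigma> - 1))\<close>, because
  \<open>(k + v) powr (- s)\<close> is \<open>k powr (- s) * exp (v z)\<close> up to the same error for \<open>0 \<le> v \<le> 1\<close>. Hence the
  differences telescope. The three cases of the theorem come from summing
  \<open>m powr (- \<sigma>\<^sub>0) * (m + x) powr (- \<sigma>)\<close> over \<open>m\<close>.
\<close>

section \<open>Powers and their increments\<close>

lemma norm_of_real_powr:
  "u \<ge> 0 \<Longrightarrow> norm (complex_of_real u powr s) = u powr Re s"
  by (simp add: norm_powr_real_powr)

lemma norm_of_nat_powr: "norm (of_nat n powr s :: complex) = real n powr Re s"
  using norm_of_real_powr[of "real n" s] by simp

text \<open>Integrals appear throughout as increments of antiderivatives, so this mean value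
  inequality takes the place of estimating an integral by a bound on its integrand.\<close>

lemma norm_increment_le:
  fixes f :: "real \<Rightarrow> complex"
  assumes "a \<le> b"
    and "\<And>v. a \<le> v \<Longrightarrow> v \<le> b \<Longrightarrow> (f has_vector_derivative f' v) (at v)"
    and "\<And>v. a \<le> v \<Longrightarrow> v \<le> b \<Longrightarrow> norm (f' v) \<le> B"
  shows "norm (f b - f a) \<le> B * (b - a)"
proof (cases "a = b")
  case False
  have "norm (f b - f a) \<le> B * b - B * a"
  proof (rule differentiable_bound_general[where f' = f' and \<phi>' = "\<lambda>_. B"])
    show "continuous_on {a..b} f"
      by (intro continuous_at_imp_continuous_on ballI has_vector_derivative_continuous[OF assms(2)]) auto
    show "((\<lambda>x. B * x) has_vector_derivative B) (at x)" for x
      by (auto intro!: derivative_eq_intros simp: has_real_derivative_iff_has_vector_derivative[symmetric])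
  qed (use assms False in \<open>auto intro!: continuous_intros\<close>)
  then show ?thesis by (simp add: algebra_simps)
qed auto

lemma has_vector_derivative_of_real_powr:
  assumes "0 < v"
  shows "((\<lambda>v. complex_of_real v powr s) has_vector_derivative s * complex_of_real v powr (s - 1)) (at v)"
  using assms
  by (intro has_vector_derivative_real_field has_field_derivative_powr)
     (auto simp: complex_nonpos_Reals_iff)

text \<open>The offset \<open>u\<close> allows the interval from \<open>k\<close> to
  \<open>k + 1\<close> to be parametrised by \<open>v\<close> in [0, 1].\<close>

lemma has_vector_derivative_powr_antideriv:
  assumes "0 < u + v" "s \<noteq> 1"
  shows "((\<lambda>v. complex_of_real (u + v) powr (1 - s) / (1 - s)) has_vector_derivative
           complex_of_real (u + v) powr (- s)) (at v)"
proof -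
  have "((\<lambda>v. complex_of_real (u + v) powr (1 - s)) has_vector_derivative
           1 *\<^sub>R ((1 - s) * complex_of_real (u + v) powr (1 - s - 1))) (at v)"
    by (rule vector_diff_chain_at[of "\<lambda>v. u + v" 1 v "\<lambda>v. complex_of_real v powr (1 - s)",
          OF _ has_vector_derivative_of_real_powr[OF assms(1)], unfolded o_def])
       (auto intro!: derivative_eq_intros simp: has_real_derivative_iff_has_vector_derivative[symmetric])
  from has_vector_derivative_divide[OF this, of "1 - s"] show ?thesis using assms by simp
qed

lemma norm_powr_antideriv_increment_le:
  assumes "0 < a" "a \<le> b" "s \<noteq> 1" "Re s \<ge> 0"
  shows "norm (complex_of_real b powr (1 - s) / (1 - s) - complex_of_real a powr (1 - s) / (1 - s))
           \<le> (b - a) * a powr (- Re s)"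
proof -
  have "norm (complex_of_real (0 + b) powr (1 - s) / (1 - s) - complex_of_real (0 + a) powr (1 - s) / (1 - s))
          \<le> a powr (- Re s) * (b - a)"
  proof (rule norm_increment_le[where f' = "\<lambda>v. complex_of_real (0 + v) powr (- s)"])
    show "norm (complex_of_real (0 + v) powr (- s)) \<le> a powr (- Re s)" if "a \<le> v" "v \<le> b" for v
      using that assms by (auto simp: norm_of_real_powr intro!: powr_mono2')
  qed (use assms in \<open>auto intro!: has_vector_derivative_powr_antideriv[of 0, simplified]\<close>)
  then show ?thesis by (simp add: mult.commute)
qed

section \<open>Tail sums of real powers\<close>

lemma powr_tail_term_le:
  assumes "\<tau> > 1" "n \<ge> 1"
  shows "real n powr (- \<tau>) \<le> 2 powr \<tau> / (\<tau> - 1) * (real n powr (1 - \<tau>) - real (Suc n) powr (1 - \<tau>))"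
proof -
  have "\<exists>z. real n < z \<and> z < real (Suc n) \<and>
          - (real (Suc n) powr (1 - \<tau>)) - - (real n powr (1 - \<tau>)) = (real (Suc n) - real n) * ((\<tau> - 1) * z powr (- \<tau>))"
    using assms by (intro MVT2) (auto intro!: derivative_eq_intros simp: field_simps)
  then obtain z where z: "real n < z" "z < real (Suc n)"
    "real n powr (1 - \<tau>) - real (Suc n) powr (1 - \<tau>) = (\<tau> - 1) * z powr (- \<tau>)" by auto
  \<comment> \<open>As n >= 1, the intermediate point satisfies z < n + 1 <= 2 n; this is the source
    of the factor \<open>2 powr \<tau>\<close>.\<close>
  have "(2 * real n) powr (- \<tau>) \<le> z powr (- \<tau>)"
    using z assms by (intro powr_mono2') auto
  then have "2 powr (- \<tau>) * real n powr (- \<tau>) \<le> z powr (- \<tau>)"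
    by (simp add: powr_mult)
  then have "2 powr \<tau> * (2 powr (- \<tau>) * real n powr (- \<tau>)) \<le> 2 powr \<tau> * z powr (- \<tau>)"
    by (intro mult_left_mono) auto
  then have "real n powr (- \<tau>) \<le> 2 powr \<tau> * z powr (- \<tau>)"
    by (simp flip: mult.assoc powr_add)
  moreover have "2 powr \<tau> / (\<tau> - 1) * ((\<tau> - 1) * z powr (- \<tau>)) = 2 powr \<tau> * z powr (- \<tau>)"
    using assms by simp
  ultimately show ?thesis unfolding z by simp
qed

lemma powr_tail:
  assumes "\<tau> > 1" "N \<ge> 1"
  shows "summable (\<lambda>j. real (N + j) powr (- \<tau>))"
    and "(\<Sum>j. real (N + j) powr (- \<tau>)) \<le> 2 powr \<tau> / (\<tau> - 1) * real N powr (1 - \<tau>)"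
proof -
  define c where "c = 2 powr \<tau> / (\<tau> - 1)"
  have c: "c > 0" using assms by (simp add: c_def)
  have bd: "(\<Sum>j<n. real (N + j) powr (- \<tau>)) \<le> c * real N powr (1 - \<tau>)" for n
  proof -
    have "(\<Sum>j<n. real (N + j) powr (- \<tau>))
        \<le> (\<Sum>j<n. c * (real (N + j) powr (1 - \<tau>) - real (N + Suc j) powr (1 - \<tau>)))"
      using powr_tail_term_le[OF assms(1), of "N + j" for j] assms(2)
      by (intro sum_mono) (simp add: c_def)
    also have "\<dots> = c * (real N powr (1 - \<tau>) - real (N + n) powr (1 - \<tau>))"
      unfolding sum_distrib_left[symmetric]
      using sum_lessThan_telescope'[of "\<lambda>j. real (N + j) powr (1 - \<tau>)" n] by simp
    also have "\<dots> \<le> c * real N powr (1 - \<tau>)"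
      using c by (intro mult_left_mono) auto
    finally show ?thesis .
  qed
  show S: "summable (\<lambda>j. real (N + j) powr (- \<tau>))"
    by (rule summableI_nonneg_bounded[where x = "c * real N powr (1 - \<tau>)"]) (use bd in auto)
  show "(\<Sum>j. real (N + j) powr (- \<tau>)) \<le> 2 powr \<tau> / (\<tau> - 1) * real N powr (1 - \<tau>)"
    using suminf_le_const[OF S bd] by (simp add: c_def)
qed

section \<open>Tails of the zeta series\<close>

text \<open>The bracket is the integral of \<open>u powr (- s)\<close> over [k, k + 1], written
  through its antiderivative so that holomorphy in \<open>s\<close> can be read off. At
  \<open>s = 1\<close> the division by zero gives a default value, hence the recurring hypothesis
  \<open>s \<noteq> 1\<close>.\<close>

definition em_diff :: "nat \<Rightarrow> complex \<Rightarrow> complex" where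
  "em_diff k s = of_nat k powr (- s) -
     (of_nat (Suc k) powr (1 - s) / (1 - s) - of_nat k powr (1 - s) / (1 - s))"

text \<open>For \<open>Re s > 1\<close> the subtracted quotient is minus the integral of
  \<open>u powr (- s)\<close> from \<open>N\<close> to infinity, so the value is the series over n
  >= N. The series of \<open>em_diff\<close> still converges for \<open>Re s > 0\<close>, which
  gives the continuation.\<close>

definition zeta_tail :: "nat \<Rightarrow> complex \<Rightarrow> complex" where
  "zeta_tail N s = (\<Sum>j. em_diff (N + j) s) - of_nat N powr (1 - s) / (1 - s)"

text \<open>\<open>em_diff k s\<close> is minus the integral over v in [0, 1] of
  \<open>(k + v) powr (- s) - k powr (- s)\<close>, and one differentiation gains a factor 1 / k.
  Because of the factor \<open>norm s\<close> the bound is not uniform in the imaginary part; it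
  serves convergence and local domination.\<close>

lemma norm_em_diff_le:
  assumes "k \<ge> 1" "s \<noteq> 1" "Re s > 0"
  shows "norm (em_diff k s) \<le> norm s * real k powr (- (Re s + 1))"
proof -
  define u where "u = real k"
  have u: "u > 0" using assms by (simp add: u_def)
  define B where "B = norm s * u powr (- (Re s + 1))"
  have *: "norm (complex_of_real (u + v) powr (- s) - complex_of_real u powr (- s)) \<le> B"
    if v: "0 \<le> v" "v \<le> 1" for v
  proof -
    have "norm (complex_of_real (u + v) powr (- s) - complex_of_real u powr (- s)) \<le> B * (u + v - u)"
    proof (rule norm_increment_le[where f' = "\<lambda>v. - s * complex_of_real v powr (- s - 1)"])
      show "norm (- s * complex_of_real w powr (- s - 1)) \<le> B" if "u \<le> w" "w \<le> u + v" for w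
        using that u assms by (auto simp: B_def norm_mult norm_of_real_powr intro!: mult_left_mono powr_mono2')
    qed (use u v in \<open>auto intro!: has_vector_derivative_of_real_powr[of _ "- s", simplified]\<close>)
    also have "\<dots> \<le> B" using v by (simp add: B_def mult_left_le)
    finally show ?thesis .
  qed
  define f where "f = (\<lambda>v. complex_of_real (u + v) powr (1 - s) / (1 - s) - complex_of_real v * complex_of_real u powr (- s))"
  have "norm (f 1 - f 0) \<le> B * (1 - 0)"
  proof (rule norm_increment_le[where f' = "\<lambda>v. complex_of_real (u + v) powr (- s) - complex_of_real u powr (- s)"])
    fix v :: real assume v: "0 \<le> v" "v \<le> 1"
    have "((\<lambda>v. complex_of_real v * complex_of_real u powr (- s)) has_vector_derivative
       complex_of_real u powr (- s)) (at v)"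
      by (rule has_vector_derivative_real_field) (auto intro!: derivative_eq_intros)
    then show "(f has_vector_derivative complex_of_real (u + v) powr (- s) - complex_of_real u powr (- s)) (at v)"
      unfolding f_def using u v assms
      by (intro has_vector_derivative_diff has_vector_derivative_powr_antideriv) auto
  qed (use * in auto)
  also have "f 1 - f 0 = - em_diff k s"
    by (simp add: f_def em_diff_def u_def algebra_simps)
  finally show ?thesis by (simp add: B_def u_def)
qed

lemma summable_em_diff:
  assumes "N \<ge> 1" "s \<noteq> 1" "Re s > 0"
  shows "summable (\<lambda>j. em_diff (N + j) s)"
proof (rule summable_comparison_test')
  show "summable (\<lambda>j. norm s * real (N + j) powr (- (Re s + 1)))"
    using assms by (intro summable_mult powr_tail) auto
  show "norm (em_diff (N + j) s) \<le> norm s * real (N + j) powr (- (Re s + 1))" for j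
    using assms norm_em_diff_le[of "N + j" s] by auto
qed

lemma sum_em_diff:
  "(\<Sum>j<n. em_diff (N + j) s) =
     (\<Sum>j<n. of_nat (N + j) powr (- s)) - (of_nat (N + n) powr (1 - s) / (1 - s) - of_nat N powr (1 - s) / (1 - s))"
  by (induction n) (auto simp: em_diff_def algebra_simps)

lemma zeta_tail_shift:
  assumes "N \<ge> 1" "s \<noteq> 1" "Re s > 0"
  shows "zeta_tail N s = (\<Sum>j<n. of_nat (N + j) powr (- s)) + zeta_tail (N + n) s"
  using suminf_split_initial_segment[OF summable_em_diff[OF assms], of n] sum_em_diff[of N s n]
  by (simp add: zeta_tail_def algebra_simps)

text \<open>For \<open>Re s > 1\<close> the antiderivative vanishes at infinity, so in the limit the
  partial sums of \<open>em_diff\<close> and of the series differ only by the boundary term at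
  \<open>N\<close>.\<close>

lemma zeta_tail_sums:
  assumes "N \<ge> 1" "Re s > 1"
  shows "(\<lambda>j. of_nat (N + j) powr (- s)) sums zeta_tail N s"
proof -
  have s: "s \<noteq> 1" using assms by auto
  have "(\<lambda>n. (\<Sum>j<n. em_diff (N + j) s)) \<longlonglongrightarrow> (\<Sum>j. em_diff (N + j) s)"
    using summable_em_diff[of N s] assms s by (intro summable_LIMSEQ) auto
  moreover have "(\<lambda>n. of_nat (N + n) powr (1 - s) / (1 - s)) \<longlonglongrightarrow> 0"
  proof (rule Lim_null_comparison)
    show "\<forall>\<^sub>F n in sequentially. norm (of_nat (N + n) powr (1 - s) / (1 - s)) \<le> real (N + n) powr (1 - Re s) / norm (1 - s)"
      by (intro always_eventually allI) (simp add: norm_divide norm_of_nat_powr del: of_nat_add)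
    have "(\<lambda>n. real (N + n) powr (1 - Re s)) \<longlonglongrightarrow> 0"
      using assms by (intro tendsto_neg_powr filterlim_compose[OF filterlim_real_sequentially]
        filterlim_tendsto_add_at_top filterlim_add_const_nat_at_top) (auto simp: add.commute[of N] filterlim_add_const_nat_at_top)
    then show "(\<lambda>n. real (N + n) powr (1 - Re s) / norm (1 - s)) \<longlonglongrightarrow> 0"
      by (rule tendsto_divide_zero)
  qed
  ultimately have "(\<lambda>n. (\<Sum>j<n. em_diff (N + j) s) + of_nat (N + n) powr (1 - s) / (1 - s)
      - of_nat N powr (1 - s) / (1 - s)) \<longlonglongrightarrow> (\<Sum>j. em_diff (N + j) s) + 0 - of_nat N powr (1 - s) / (1 - s)"
    by (intro tendsto_intros)
  then show ?thesis
    unfolding sums_def zeta_tail_def sum_em_diff by simp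
qed

lemma norm_zeta_tail_le:
  assumes "N \<ge> 1" "s \<noteq> 1" "Re s > 0"
  shows "norm (zeta_tail N s) \<le>
    norm s * (2 powr (Re s + 1) / Re s * real N powr (- Re s)) + real N powr (1 - Re s) / norm (1 - s)"
proof -
  have "norm (\<Sum>j. em_diff (N + j) s) \<le> (\<Sum>j. norm s * real (N + j) powr (- (Re s + 1)))"
    using assms norm_em_diff_le[of "N + j" s for j]
    by (intro norm_suminf_le summable_mult powr_tail) auto
  also have "\<dots> = norm s * (\<Sum>j. real (N + j) powr (- (Re s + 1)))"
    using assms by (intro suminf_mult powr_tail) auto
  also have "\<dots> \<le> norm s * (2 powr (Re s + 1) / Re s * real N powr (- Re s))"
    using powr_tail(2)[of "Re s + 1" N] assms by (intro mult_left_mono) auto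
  finally have "norm (\<Sum>j. em_diff (N + j) s) \<le> norm s * (2 powr (Re s + 1) / Re s * real N powr (- Re s))" .
  then show ?thesis
    unfolding zeta_tail_def
    by (intro norm_triangle_le_diff add_mono) (auto simp: norm_divide norm_of_nat_powr)
qed

section \<open>Truncation of the tails\<close>

text \<open>
  The function \<open>h\<close> below is \<open>1 / (exp z - 1) - 1 / z\<close> with its removable singularity at 0 filled in;
  it is regular up to the poles at \<open>\<plusminus>2\<pi>\<i>\<close>, which is where the condition \<open>C > 1\<close> enters.
\<close>

lemma bernoulli_function_exists:
  fixes C :: real
  assumes "C > 1"
  obtains h :: "complex \<Rightarrow> complex" and H L :: real
  where "H \<ge> 0" "L \<ge> 0"
    "\<And>z. norm z \<le> 2 * pi / C \<Longrightarrow> norm (h z) \<le> H"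
    "\<And>z w. norm z \<le> 2 * pi / C \<Longrightarrow> norm w \<le> 2 * pi / C \<Longrightarrow> norm (h z - h w) \<le> L * norm (z - w)"
    "\<And>z. norm z \<le> 2 * pi / C \<Longrightarrow> z \<noteq> 0 \<Longrightarrow> 1 - (exp z - 1) / z = (exp z - 1) * h z"
proof -
  define \<phi> :: "complex \<Rightarrow> complex" where "\<phi> = (\<lambda>z. if z = 0 then 1 else (exp z - 1) / z)"
  define B where "B = ball (0::complex) (2 * pi)"
  have "(\<lambda>z. if z = 0 then deriv exp 0 else (exp z - exp 0) / (z - 0)) holomorphic_on (B :: complex set)"
    unfolding B_def by (intro pole_lemma_open holomorphic_intros) auto
  moreover have "deriv exp (0::complex) = 1"
    using DERIV_imp_deriv[OF DERIV_exp, of "0::complex"] by simp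
  ultimately have hol\<phi>: "\<phi> holomorphic_on B"
    by (simp add: \<phi>_def cong: if_cong)
  \<comment> \<open>The zeros of \<open>exp z - 1\<close> are the integer multiples of 2 pi i, and 0
    is the only one in the open ball of radius 2 pi.\<close>
  have nz: "exp z \<noteq> 1" if "z \<in> B" "z \<noteq> 0" for z
  proof
    assume "exp z = 1"
    then obtain n :: int where n: "Re z = 0" "Im z = of_int (2 * n) * pi"
      by (auto simp: exp_eq_1)
    then have "n \<noteq> 0" using that by (auto simp: complex_eq_iff)
    then have "\<bar>real_of_int n\<bar> \<ge> 1" by linarith
    moreover have "\<bar>Im z\<bar> < 2 * pi"
      using that(1) abs_Im_le_cmod[of z] by (simp add: B_def)
    then have "2 * pi * \<bar>real_of_int n\<bar> < 2 * pi * 1" using n by (simp add: abs_mult)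
    then have "\<bar>real_of_int n\<bar> < 1" by (subst (asm) mult_less_cancel_left_pos) auto
    ultimately show False by simp
  qed
  have \<phi>nz: "\<phi> z \<noteq> 0" if "z \<in> B" for z
    using nz[OF that] by (auto simp: \<phi>_def)
  \<comment> \<open>This is the difference quotient at 0 of \<open>1 / \<phi>\<close>, whose value
    at 0 is 1. Away from 0 it equals (z / (exp z - 1) - 1) / z = 1 / (exp z - 1) - 1 / z.\<close>
  define h where "h = (\<lambda>z. if z = 0 then deriv (\<lambda>z. 1 / \<phi> z) 0 else (1 / \<phi> z - 1 / \<phi> 0) / (z - 0))"
  have "(\<lambda>z. 1 / \<phi> z) holomorphic_on B"
    using hol\<phi> \<phi>nz by (intro holomorphic_intros) auto
  then have holh: "h holomorphic_on B"
    unfolding h_def by (rule pole_lemma_open) (simp add: B_def)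
  define K where "K = cball (0::complex) (2 * pi / C)"
  have "2 * pi / C < 2 * pi" using assms by (simp add: field_simps)
  then have KB: "K \<subseteq> B" by (auto simp: K_def B_def)
  have K: "compact K" "convex K" by (auto simp: K_def)
  have oB: "open B" by (simp add: B_def)
  have dh: "deriv h holomorphic_on B" using holomorphic_deriv[OF holh oB] .
  obtain H where H: "\<And>z. z \<in> K \<Longrightarrow> norm (h z) \<le> H" "H \<ge> 0"
  proof -
    have "bounded (h ` K)"
      using holomorphic_on_imp_continuous_on[OF holomorphic_on_subset[OF holh KB]] K
      by (intro compact_imp_bounded compact_continuous_image)
    then show ?thesis using that by (auto simp: bounded_pos intro: less_imp_le)
  qed
  \<comment> \<open>On the convex disc \<open>K\<close> a bound for the derivative is a Lipschitz
    constant for \<open>h\<close>.\<close>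
  obtain L where L: "\<And>z. z \<in> K \<Longrightarrow> norm (deriv h z) \<le> L" "L \<ge> 0"
  proof -
    have "bounded (deriv h ` K)"
      using holomorphic_on_imp_continuous_on[OF holomorphic_on_subset[OF dh KB]] K
      by (intro compact_imp_bounded compact_continuous_image)
    then show ?thesis using that by (auto simp: bounded_pos intro: less_imp_le)
  qed
  show ?thesis
  proof (rule that[of H L h])
    fix z w :: complex assume zw: "norm z \<le> 2 * pi / C" "norm w \<le> 2 * pi / C"
    show "norm (h z - h w) \<le> L * norm (z - w)"
    proof (rule field_differentiable_bound[OF K(2)])
      show "(h has_field_derivative deriv h z) (at z within K)" if "z \<in> K" for z
        using holomorphic_derivI[OF holh oB] that KB by (blast intro: has_field_derivative_at_within)
    qed (use L zw in \<open>auto simp: K_def\<close>)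
  next
    fix z :: complex assume z: "norm z \<le> 2 * pi / C" "z \<noteq> 0"
    then have "exp z \<noteq> 1" using nz[of z] KB by (auto simp: K_def)
    with z show "1 - (exp z - 1) / z = (exp z - 1) * h z"
      by (simp add: h_def \<phi>_def field_simps)
  qed (use H L in \<open>auto simp: K_def\<close>)
qed

section \<open>Local comparison of powers with exponentials\<close>

lemma norm_exp_i_diff_le: "norm (exp (\<i> * of_real a) - exp (\<i> * of_real b)) \<le> \<bar>a - b\<bar>"
proof -
  have "norm (exp (\<i> * of_real a) - exp (\<i> * of_real b)) \<le> 1 * norm (\<i> * of_real a - \<i> * of_real b :: complex)"
    by (rule field_differentiable_bound[where S = "{z. Re z = 0}" and f' = exp])
       (auto intro!: derivative_eq_intros convex_hyperplane simp: norm_exp_eq_Re convex_halfspace_Re_ge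
         intro: convexI)
  then show ?thesis by (simp add: norm_mult flip: right_diff_distrib of_real_diff)
qed

lemma ln_1_plus_approx:
  fixes q :: real
  assumes "q \<ge> 0"
  shows "0 \<le> ln (1 + q)" "ln (1 + q) \<le> q" "\<bar>ln (1 + q) - q\<bar> \<le> q\<^sup>2"
proof -
  show a: "0 \<le> ln (1 + q)" "ln (1 + q) \<le> q"
    using assms by (auto intro: ln_add_one_self_le_self)
  have "q - q\<^sup>2 \<le> ln (1 + q)"
  proof (cases "q \<le> 1")
    case True then show ?thesis using ln_one_plus_pos_lower_bound[of q] assms by auto
  next
    case False
    then have "q * 1 \<le> q * q" by (intro mult_left_mono) auto
    then have "q - q\<^sup>2 \<le> 0" by (simp add: power2_eq_square)
    then show ?thesis using a by linarith
  qed
  then show "\<bar>ln (1 + q) - q\<bar> \<le> q\<^sup>2" using a by simp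
qed

text \<open>With \<open>l = ln (1 + v / u)\<close>, the ratio of the two powers is
  \<open>exp (- \<sigma> * l) * exp (- \<i> * t * l)\<close>. Replacing the first factor by 1 costs
  at most \<sigma> / u. Replacing l by v / u in the phase costs at most |t| (v / u)^2 <= 2 pi / u,
  because |t| <= 2 pi u. No factor |t| survives, which is what makes the later estimates
  uniform.\<close>

lemma powr_shift_approx:
  fixes u v :: real and s :: complex
  assumes "u > 0" "0 \<le> v" "v \<le> 1" "Re s \<ge> 0" "\<bar>Im s\<bar> \<le> 2 * pi * u"
  shows "norm (of_real (u + v) powr (- s) - of_real u powr (- s) * exp (of_real v * - (\<i> * of_real (Im s / u))))
          \<le> (Re s + 2 * pi) * u powr (- (Re s + 1))"
proof -
  define q where "q = v / u"
  define l where "l = ln (1 + q)"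
  define \<sigma> where "\<sigma> = Re s"
  define t where "t = Im s"
  have q: "q \<ge> 0" "q \<le> 1 / u" using assms by (auto simp: q_def divide_right_mono)
  note l = ln_1_plus_approx[OF q(1), folded l_def]
  have ln: "ln (u + v) = ln u + l"
  proof -
    have "u + v = u * (1 + q)" using assms by (simp add: q_def field_simps)
    then show ?thesis using assms q by (simp add: l_def ln_mult)
  qed
  have s: "s = of_real \<sigma> + \<i> * of_real t" by (simp add: \<sigma>_def t_def complex_eq_iff)
  have "complex_of_real (u + v) powr (- s) = exp (- s * of_real (ln (u + v)))"
    using assms by (simp add: powr_def Ln_of_real flip: of_real_add)
  also have "\<dots> = exp (- s * of_real (ln u)) * exp (- s * of_real l)"
    by (simp add: ln algebra_simps flip: exp_add)
  also have "exp (- s * of_real (ln u)) = complex_of_real u powr (- s)"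
    using assms by (simp add: powr_def Ln_of_real)
  also have "exp (- s * of_real l) = of_real (exp (- \<sigma> * l)) * exp (\<i> * of_real (- t * l))"
    by (simp add: s algebra_simps flip: exp_of_real exp_add)
  finally have e1: "complex_of_real (u + v) powr (- s) =
    complex_of_real u powr (- s) * (of_real (exp (- \<sigma> * l)) * exp (\<i> * of_real (- t * l)))" .
  have e2: "of_real v * - (\<i> * of_real (Im s / u)) = \<i> * complex_of_real (- t * q)"
    by (simp add: t_def q_def)
  have b1: "\<bar>exp (- \<sigma> * l) - 1\<bar> \<le> \<sigma> * q"
  proof -
    have "exp (- \<sigma> * l) \<ge> 1 + (- \<sigma> * l)" by (rule exp_ge_add_one_self)
    moreover have "\<sigma> * l \<ge> 0" using l assms by (simp add: \<sigma>_def)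
    moreover have "exp (- \<sigma> * l) \<le> 1" using \<open>\<sigma> * l \<ge> 0\<close> by simp
    moreover have "\<sigma> * l \<le> \<sigma> * q" using l assms by (simp add: \<sigma>_def mult_left_mono)
    ultimately show ?thesis by (simp add: abs_if)
  qed
  have b2: "\<bar>- t * l - - t * q\<bar> \<le> 2 * pi / u"
  proof -
    have "\<bar>- t * l - - t * q\<bar> = \<bar>t\<bar> * \<bar>l - q\<bar>"
      by (simp flip: abs_mult) (simp add: algebra_simps abs_minus_commute)
    also have "\<dots> \<le> (2 * pi * u) * q\<^sup>2" using l assms by (intro mult_mono) (auto simp: t_def)
    also have "\<dots> \<le> (2 * pi * u) * (1 / u)\<^sup>2" using q assms by (intro mult_left_mono power_mono) auto
    also have "\<dots> = 2 * pi / u" using assms by (simp add: power2_eq_square)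
    finally show ?thesis .
  qed
  have "norm (of_real (exp (- \<sigma> * l)) * exp (\<i> * of_real (- t * l)) - exp (\<i> * of_real (- t * q)))
      = norm (of_real (exp (- \<sigma> * l) - 1) * exp (\<i> * of_real (- t * l)) + (exp (\<i> * of_real (- t * l)) - exp (\<i> * of_real (- t * q))))"
    by (simp add: algebra_simps)
  also have "\<dots> \<le> norm (of_real (exp (- \<sigma> * l) - 1) * exp (\<i> * of_real (- t * l))) + norm (exp (\<i> * of_real (- t * l)) - exp (\<i> * of_real (- t * q)))"
    by (rule norm_triangle_ineq)
  also have "norm (of_real (exp (- \<sigma> * l) - 1) * exp (\<i> * of_real (- t * l))) = \<bar>exp (- \<sigma> * l) - 1\<bar>"
    by (simp only: norm_mult norm_of_real norm_exp_i_times mult_1_right)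
  also have "\<dots> + norm (exp (\<i> * of_real (- t * l)) - exp (\<i> * of_real (- t * q))) \<le> \<sigma> * q + 2 * pi / u"
    using b1 b2 norm_exp_i_diff_le[of "- t * l" "- t * q"] by linarith
  also have "\<sigma> * q \<le> \<sigma> * (1 / u)" using q assms by (intro mult_left_mono) (auto simp: \<sigma>_def)
  finally have "norm (of_real (exp (- \<sigma> * l)) * exp (\<i> * of_real (- t * l)) - exp (\<i> * of_real (- t * q))) \<le> (\<sigma> + 2 * pi) * (1 / u)"
    by (simp add: add_divide_distrib)
  then have "u powr (- \<sigma>) * norm (of_real (exp (- \<sigma> * l)) * exp (\<i> * of_real (- t * l)) - exp (\<i> * of_real (- t * q))) \<le> u powr (- \<sigma>) * ((\<sigma> + 2 * pi) * (1 / u))"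
    by (intro mult_left_mono) auto
  also have "\<dots> = (\<sigma> + 2 * pi) * u powr (- (\<sigma> + 1))"
    using assms by (simp add: powr_diff)
  finally show ?thesis
    unfolding e1 e2 right_diff_distrib[symmetric] norm_mult using assms
    by (simp add: norm_of_real_powr \<sigma>_def)
qed

text \<open>The preceding approximation is integrated over v in [0, 1]: \<open>exp (v * z)\<close>
  integrates to \<open>(exp z - 1) / z\<close>, or to 1 when \<open>z = 0\<close>.\<close>

lemma powr_integral_approx:
  fixes u :: real and s :: complex
  assumes "u > 0" "s \<noteq> 1" "Re s \<ge> 0" "\<bar>Im s\<bar> \<le> 2 * pi * u"
  defines "z \<equiv> - (\<i> * of_real (Im s / u))"
  shows "norm (of_real (u + 1) powr (1 - s) / (1 - s) - of_real u powr (1 - s) / (1 - s)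
           - of_real u powr (- s) * (if z = 0 then 1 else (exp z - 1) / z))
          \<le> (Re s + 2 * pi) * u powr (- (Re s + 1))"
proof -
  define E where "E = (\<lambda>v. if z = 0 then complex_of_real v else exp (of_real v * z) / z)"
  have E: "(E has_vector_derivative exp (of_real v * z)) (at v)" for v
  proof (cases "z = 0")
    case True
    have "(complex_of_real has_vector_derivative 1) (at v)"
      by (rule has_vector_derivative_real_field[of "\<lambda>x. x"]) auto
    then show ?thesis using True by (simp add: E_def)
  next
    case False
    have "((\<lambda>v. exp (of_real v * z) / z) has_vector_derivative exp (of_real v * z)) (at v)"
      by (rule has_vector_derivative_real_field[of "\<lambda>x. exp (x * z) / z"])
         (use False in \<open>auto intro!: derivative_eq_intros\<close>)
    then show ?thesis using False by (simp add: E_def)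
  qed
  define f where "f = (\<lambda>v. complex_of_real (u + v) powr (1 - s) / (1 - s) - of_real u powr (- s) * E v)"
  have "norm (f 1 - f 0) \<le> (Re s + 2 * pi) * u powr (- (Re s + 1)) * (1 - 0)"
  proof (rule norm_increment_le)
    fix v :: real assume v: "0 \<le> v" "v \<le> 1"
    show "(f has_vector_derivative of_real (u + v) powr (- s) - of_real u powr (- s) * exp (of_real v * z)) (at v)"
      unfolding f_def using assms v
      by (intro has_vector_derivative_diff has_vector_derivative_powr_antideriv
            has_vector_derivative_mult_right E) auto
    show "norm (of_real (u + v) powr (- s) - of_real u powr (- s) * exp (of_real v * z))
        \<le> (Re s + 2 * pi) * u powr (- (Re s + 1))"
      unfolding z_def using assms v by (intro powr_shift_approx) auto
  qed auto
  moreover have "E 1 - E 0 = (if z = 0 then 1 else (exp z - 1) / z)"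
    by (simp add: E_def diff_divide_distrib)
  then have "f 1 - f 0 = of_real (u + 1) powr (1 - s) / (1 - s) - of_real u powr (1 - s) / (1 - s)
           - of_real u powr (- s) * (if z = 0 then 1 else (exp z - 1) / z)"
    unfolding f_def by (simp only: add_0_right) (simp add: algebra_simps flip: \<open>E 1 - E 0 = _\<close>)
  ultimately show ?thesis by simp
qed

text \<open>Up to admissible errors \<open>em_diff k s\<close> is
  \<open>k powr (- s) * (exp z - 1) * h z\<close>. Multiplication by \<open>exp z\<close>
  approximately turns \<open>k powr (- s)\<close> into \<open>Suc k powr (- s)\<close>, so this
  product is close to a difference of consecutive values of \<open>g\<close>.\<close>

lemma em_diff_telescope_approx:
  fixes h :: "complex \<Rightarrow> complex" and H L C :: real
  assumes C: "C > 1" and HL: "H \<ge> 0" "L \<ge> 0"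
    and hb: "\<And>z. norm z \<le> 2 * pi / C \<Longrightarrow> norm (h z) \<le> H"
    and hL: "\<And>z w. norm z \<le> 2 * pi / C \<Longrightarrow> norm w \<le> 2 * pi / C \<Longrightarrow> norm (h z - h w) \<le> L * norm (z - w)"
    and heq: "\<And>z. norm z \<le> 2 * pi / C \<Longrightarrow> z \<noteq> 0 \<Longrightarrow> 1 - (exp z - 1) / z = (exp z - 1) * h z"
    and s: "s \<noteq> 1" "Re s \<ge> 0" and k: "k \<ge> 1" "\<bar>Im s\<bar> \<le> 2 * pi * real k / C"
  defines "g \<equiv> \<lambda>k::nat. of_nat k powr (- s) * h (- (\<i> * of_real (Im s / real k)))"
  shows "norm (em_diff k s - (g (Suc k) - g k))
      \<le> ((Re s + 2 * pi) * (1 + H) + 2 * pi * L) * real k powr (- (Re s + 1))"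
proof -
  define z z' where "z = - (\<i> * complex_of_real (Im s / real k))" and "z' = - (\<i> * complex_of_real (Im s / real (Suc k)))"
  define A where "A = (Re s + 2 * pi) * real k powr (- (Re s + 1))"
  define p p' where "p = complex_of_nat k powr (- s)" and "p' = complex_of_nat (Suc k) powr (- s)"
  define \<phi> where "\<phi> = (if z = 0 then 1 else (exp z - 1) / z)"
  define J where "J = complex_of_nat (Suc k) powr (1 - s) / (1 - s) - of_nat k powr (1 - s) / (1 - s)"
  have k0: "real k > 0" using k by auto
  have "2 * pi * real k / C \<le> 2 * pi * real k" using C mult_left_mono[of 1 C "real k"] by (simp add: divide_le_eq)
  then have t: "\<bar>Im s\<bar> \<le> 2 * pi * real k" using k by linarith
  have nz: "norm z \<le> 2 * pi / C"
  proof -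
    have "\<bar>Im s\<bar> / real k \<le> (2 * pi * real k / C) / real k"
      using k by (intro divide_right_mono) auto
    then show ?thesis using k0 by (simp add: z_def norm_mult norm_divide)
  qed
  have nz': "norm z' \<le> 2 * pi / C"
  proof -
    have "\<bar>Im s\<bar> / real (Suc k) \<le> \<bar>Im s\<bar> / real k" using k0 by (intro divide_left_mono) auto
    then show ?thesis using nz by (simp add: z_def z'_def norm_mult norm_divide del: of_nat_Suc)
  qed
  have J: "norm (J - p * \<phi>) \<le> A"
    using powr_integral_approx[OF k0 s t, folded z_def \<phi>_def]
    by (simp add: J_def p_def A_def add.commute)
  have P: "norm (p' - p * exp z) \<le> A"
    using powr_shift_approx[OF k0 _ _ s(2) t, of 1, folded z_def] by (simp add: p_def p'_def A_def add.commute)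
  have ph: "1 - \<phi> = (exp z - 1) * h z"
    using heq[OF nz] by (auto simp: \<phi>_def)
  \<comment> \<open>The arguments at k and k + 1 differ by |t| / (k (k + 1)), and |t| <= 2 pi
    k.\<close>
  have dz: "norm (z' - z) \<le> 2 * pi / real k"
  proof -
    have "z' - z = \<i> * of_real (Im s * (1 / real k - 1 / real (Suc k)))"
      by (simp add: z_def z'_def algebra_simps)
    also have "1 / real k - 1 / real (Suc k) = 1 / (real k * real (Suc k))"
      using k0 by (simp add: field_simps)
    also have "norm (\<i> * complex_of_real (Im s * (1 / (real k * real (Suc k))))) = \<bar>Im s\<bar> / (real k * real (Suc k))"
      by (simp only: norm_mult norm_of_real abs_mult norm_ii) simp
    also have "\<dots> \<le> (2 * pi * real k) / (real k * real k)"
      using t k0 by (intro frac_le) auto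
    also have "\<dots> = 2 * pi / real k" using k0 by simp
    finally show ?thesis .
  qed
  have np: "norm p = real k powr (- Re s)" by (simp add: p_def norm_of_nat_powr)
  have ez: "norm (exp z) = 1" by (simp add: z_def norm_exp_eq_Re)
  have kk: "real k powr (- Re s) / real k = real k powr (- (Re s + 1))"
    using k0 by (simp add: powr_diff)
  have "em_diff k s - (g (Suc k) - g k) = p * (1 - \<phi>) - (J - p * \<phi>) - (p' * h z' - p * h z)"
    unfolding em_diff_def g_def p_def p'_def z_def z'_def J_def by (simp add: algebra_simps)
  \<comment> \<open>The three errors come from the integral, from the shift of the power, and from
    the variation of \<open>h\<close>. They are bounded by \<open>A\<close>, by
    \<open>A * H\<close>, and through the Lipschitz constant \<open>L\<close>.\<close>
  also have "\<dots> = - (J - p * \<phi>) - (p' - p * exp z) * h z' - p * exp z * (h z' - h z)"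
    unfolding ph by (simp add: algebra_simps)
  also have "norm \<dots> \<le> norm (J - p * \<phi>) + norm ((p' - p * exp z) * h z') + norm (p * exp z * (h z' - h z))"
    using norm_triangle_ineq4[of "- (J - p * \<phi>) - (p' - p * exp z) * h z'" "p * exp z * (h z' - h z)"]
      norm_triangle_ineq4[of "- (J - p * \<phi>)" "(p' - p * exp z) * h z'"]
    by (simp only: norm_minus_cancel)
  also have "\<dots> \<le> A + A * H + real k powr (- Re s) * (L * (2 * pi / real k))"
  proof (intro add_mono J)
    show "norm ((p' - p * exp z) * h z') \<le> A * H"
      unfolding norm_mult using P hb[OF nz'] HL by (intro mult_mono order.trans[OF norm_ge_zero P]) auto
    have "norm (h z' - h z) \<le> L * norm (z' - z)" using hL nz nz' by auto
    also have "\<dots> \<le> L * (2 * pi / real k)" using dz HL by (intro mult_left_mono)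
    finally show "norm (p * exp z * (h z' - h z)) \<le> real k powr (- Re s) * (L * (2 * pi / real k))"
      unfolding norm_mult np ez mult_1_right by (intro mult_left_mono) auto
  qed
  also have "real k powr (- Re s) * (L * (2 * pi / real k)) = 2 * pi * L * (real k powr (- Re s) / real k)"
    by simp
  also have "A + A * H + \<dots> = ((Re s + 2 * pi) * (1 + H) + 2 * pi * L) * real k powr (- (Re s + 1))"
    unfolding kk A_def by (simp add: algebra_simps)
  finally show ?thesis .
qed

lemma of_nat_powr_tendsto_0:
  assumes "\<sigma> > 0"
  shows "(\<lambda>n. real (N + n) powr (- \<sigma>)) \<longlonglongrightarrow> 0"
  using assms by (intro tendsto_neg_powr filterlim_compose[OF filterlim_real_sequentially])
    (auto simp: add.commute[of N] filterlim_add_const_nat_at_top)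

text \<open>Summing the telescoping approximation from \<open>P\<close> on leaves the remainders and
  the boundary value \<open>g P\<close>, each of order \<open>P powr (- \<sigma>)\<close>. The cut
  point \<open>y\<close> is kept apart from the integer \<open>P\<close> because the truncation in
  the theorem is at a real \<open>x\<close>.\<close>

lemma zeta_tail_approx:
  fixes C \<sigma> :: real
  assumes C: "C > 1" and \<sigma>: "\<sigma> > 0"
  obtains K where "K \<ge> 0"
    "\<And>P y s. Re s = \<sigma> \<Longrightarrow> s \<noteq> 1 \<Longrightarrow> y > 0 \<Longrightarrow> y \<le> real P \<Longrightarrow> real P \<le> y + 1 \<Longrightarrow>
       \<bar>Im s\<bar> \<le> 2 * pi * y / C \<Longrightarrow>
       norm (zeta_tail P s + of_real y powr (1 - s) / (1 - s)) \<le> K * y powr (- \<sigma>)"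
proof -
  obtain h :: "complex \<Rightarrow> complex" and H L where HL: "H \<ge> 0" "L \<ge> 0"
    and hb: "\<And>z. norm z \<le> 2 * pi / C \<Longrightarrow> norm (h z) \<le> H"
    and hL: "\<And>z w. norm z \<le> 2 * pi / C \<Longrightarrow> norm w \<le> 2 * pi / C \<Longrightarrow> norm (h z - h w) \<le> L * norm (z - w)"
    and heq: "\<And>z. norm z \<le> 2 * pi / C \<Longrightarrow> z \<noteq> 0 \<Longrightarrow> 1 - (exp z - 1) / z = (exp z - 1) * h z"
    by (rule bernoulli_function_exists[OF C]) (rule that; assumption)
  define K0 where "K0 = (\<sigma> + 2 * pi) * (1 + H) + 2 * pi * L"
  have K0: "K0 \<ge> 0" using HL \<sigma> by (simp add: K0_def)
  define K1 where "K1 = K0 * (2 powr (\<sigma> + 1) / \<sigma>)"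
  have K1: "K1 \<ge> 0" using K0 \<sigma> by (simp add: K1_def)
  show ?thesis
  \<comment> \<open>\<open>K1\<close> accounts for the remainders, \<open>H\<close> for the boundary
    value \<open>g P\<close>, and 1 for moving the endpoint from \<open>P\<close> to
    \<open>y\<close>, a distance of at most 1.\<close>
  proof (rule that[of "K1 + H + 1"])
    fix P :: nat and y :: real and s :: complex
    assume s: "Re s = \<sigma>" "s \<noteq> 1" and y: "y > 0" "y \<le> real P" "real P \<le> y + 1" and t: "\<bar>Im s\<bar> \<le> 2 * pi * y / C"
    have P: "P \<ge> 1" using y by (cases P) auto
    define g where "g = (\<lambda>k::nat. of_nat k powr (- s) * h (- (\<i> * of_real (Im s / real k))))"
    have tk: "\<bar>Im s\<bar> \<le> 2 * pi * real k / C" if "k \<ge> P" for k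
    proof -
      have "2 * pi * y / C \<le> 2 * pi * real k / C"
        using that y C by (intro divide_right_mono mult_left_mono) auto
      then show ?thesis using t by linarith
    qed
    have gb: "norm (g k) \<le> H * real k powr (- \<sigma>)" if "k \<ge> P" for k
    proof -
      have "norm (h (- (\<i> * of_real (Im s / real k)))) \<le> H"
      proof (rule hb)
        have "\<bar>Im s\<bar> / real k \<le> (2 * pi * real k / C) / real k"
          using tk[OF that] by (intro divide_right_mono) auto
        then show "norm (- (\<i> * complex_of_real (Im s / real k))) \<le> 2 * pi / C"
          using that P by (simp add: norm_mult norm_divide)
      qed
      from mult_left_mono[OF this, of "real k powr (- \<sigma>)"] show ?thesis
        unfolding g_def norm_mult norm_of_nat_powr by (simp add: s mult.commute)
    qed
    define r where "r = (\<lambda>j. em_diff (P + j) s - (g (P + Suc j) - g (P + j)))"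
    have rb: "norm (r j) \<le> K0 * real (P + j) powr (- (\<sigma> + 1))" for j
      using em_diff_telescope_approx[OF C HL hb hL heq s(2) _ _ tk, of "P + j"] P \<sigma> s(1)
      by (simp add: r_def g_def K0_def)
    have g0: "(\<lambda>j. g (P + j)) \<longlonglongrightarrow> 0"
    proof (rule Lim_null_comparison)
      show "(\<lambda>j. H * real (P + j) powr (- \<sigma>)) \<longlonglongrightarrow> 0"
        by (rule tendsto_mult_right_zero[OF of_nat_powr_tendsto_0[OF \<sigma>]])
    qed (use gb[of "P + j" for j] in auto)
    have "r sums ((\<Sum>j. em_diff (P + j) s) - (0 - g (P + 0)))"
      unfolding r_def using P s \<sigma>
      by (intro sums_diff summable_sums summable_em_diff telescope_sums[OF g0]) auto
    then have eq: "(\<Sum>j. em_diff (P + j) s) = suminf r - g P"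
      by (simp add: sums_iff)
    have "norm (suminf r) \<le> (\<Sum>j. K0 * real (P + j) powr (- (\<sigma> + 1)))"
      using rb \<sigma> P by (intro norm_suminf_le summable_mult powr_tail) auto
    also have "\<dots> = K0 * (\<Sum>j. real (P + j) powr (- (\<sigma> + 1)))"
      using \<sigma> P by (intro suminf_mult powr_tail) auto
    also have "\<dots> \<le> K0 * (2 powr (\<sigma> + 1) / \<sigma> * real P powr (- \<sigma>))"
      using powr_tail(2)[of "\<sigma> + 1" P] \<sigma> P K0 by (intro mult_left_mono) auto
    also have "\<dots> = K1 * real P powr (- \<sigma>)" by (simp add: K1_def)
    finally have b1: "norm (suminf r) \<le> K1 * real P powr (- \<sigma>)" .
    have b2: "norm (complex_of_real (real P) powr (1 - s) / (1 - s) - of_real y powr (1 - s) / (1 - s))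
        \<le> y powr (- \<sigma>)"
    proof -
      have "norm (complex_of_real (real P) powr (1 - s) / (1 - s) - of_real y powr (1 - s) / (1 - s))
        \<le> (real P - y) * y powr (- \<sigma>)"
        using norm_powr_antideriv_increment_le[OF y(1,2) s(2)] s \<sigma> by simp
      also have "\<dots> \<le> 1 * y powr (- \<sigma>)" using y by (intro mult_right_mono) auto
      finally show ?thesis by simp
    qed
    define Q where "Q = complex_of_real (real P) powr (1 - s) / (1 - s) - of_real y powr (1 - s) / (1 - s)"
    have Py: "real P powr (- \<sigma>) \<le> y powr (- \<sigma>)" using y \<sigma> by (intro powr_mono2') auto
    have "zeta_tail P s + of_real y powr (1 - s) / (1 - s) =
      suminf r - g P - Q"
      by (simp add: zeta_tail_def eq Q_def)
    also have "norm \<dots> \<le> norm (suminf r) + norm (g P) + y powr (- \<sigma>)"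
      using b2[folded Q_def] norm_triangle_ineq4[of "suminf r - g P" Q] norm_triangle_ineq4[of "suminf r" "g P"]
      by linarith
    also have "\<dots> \<le> K1 * y powr (- \<sigma>) + H * y powr (- \<sigma>) + y powr (- \<sigma>)"
      using b1 gb[of P] mult_left_mono[OF Py K1] mult_left_mono[OF Py HL(1)] by linarith
    finally show "norm (zeta_tail P s + of_real y powr (1 - s) / (1 - s)) \<le> (K1 + H + 1) * y powr (- \<sigma>)"
      by (simp add: algebra_simps)
  qed (use K1 HL in auto)
qed

section \<open>Continuation of the double zeta function\<close>

text \<open>Majorants are required only locally, since those at hand degenerate towards the boundary
  of the region and towards \<open>s2 = 1\<close>. The general domain type admits pairs of complex
  numbers.\<close>

lemma continuous_on_dominated_series:
  fixes f :: "nat \<Rightarrow> 'a::t2_space \<Rightarrow> complex"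
  assumes "open W" and f: "\<And>n. continuous_on W (f n)"
    and dom: "\<And>p. p \<in> W \<Longrightarrow> \<exists>V M. open V \<and> p \<in> V \<and> summable M \<and> (\<forall>q\<in>V \<inter> W. \<forall>n. norm (f n q) \<le> M n)"
  shows "continuous_on W (\<lambda>q. \<Sum>n. f n q)"
proof (intro continuous_at_imp_continuous_on ballI)
  fix p assume p: "p \<in> W"
  obtain V M where V: "open V" "p \<in> V" "summable M" "\<forall>q\<in>V \<inter> W. \<forall>n. norm (f n q) \<le> M n"
    using dom[OF p] by (elim exE conjE) (rule that)
  have "continuous_on (V \<inter> W) (\<lambda>q. \<Sum>n. f n q)"
  proof (rule uniform_limit_theorem)
    show "uniform_limit (V \<inter> W) (\<lambda>n q. \<Sum>i<n. f i q) (\<lambda>q. \<Sum>n. f n q) sequentially"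
      using V by (intro Weierstrass_m_test) auto
    show "\<forall>\<^sub>F n in sequentially. continuous_on (V \<inter> W) (\<lambda>q. \<Sum>i<n. f i q)"
      by (intro always_eventually allI continuous_on_sum continuous_on_subset[OF f]) auto
  qed auto
  then show "isCont (\<lambda>q. \<Sum>n. f n q) p"
    using V p \<open>open W\<close> by (subst (asm) continuous_on_eq_continuous_at) auto
qed

lemma holomorphic_on_dominated_series:
  fixes f :: "nat \<Rightarrow> complex \<Rightarrow> complex"
  assumes "open W" and f: "\<And>n. f n holomorphic_on W"
    and dom: "\<And>p. p \<in> W \<Longrightarrow> \<exists>V M. open V \<and> p \<in> V \<and> summable M \<and> (\<forall>q\<in>V \<inter> W. \<forall>n. norm (f n q) \<le> M n)"
  shows "(\<lambda>q. \<Sum>n. f n q) holomorphic_on W"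
proof (rule holomorphic_uniform_sequence[OF \<open>open W\<close>])
  show "(\<lambda>q. \<Sum>i<n. f i q) holomorphic_on W" for n
    by (intro holomorphic_on_sum f)
  fix p assume p: "p \<in> W"
  obtain V M where V: "open V" "p \<in> V" "summable M" "\<forall>q\<in>V \<inter> W. \<forall>n. norm (f n q) \<le> M n"
    using dom[OF p] by (elim exE conjE) (rule that)
  have "open (V \<inter> W)" "p \<in> V \<inter> W" using V p \<open>open W\<close> by auto
  then obtain d where d: "d > 0" "cball p d \<subseteq> V \<inter> W"
    by (meson open_contains_cball)
  have "uniform_limit (cball p d) (\<lambda>n q. \<Sum>i<n. f i q) (\<lambda>q. \<Sum>n. f n q) sequentially"
  proof (rule Weierstrass_m_test[OF _ V(3)])
    show "norm (f n q) \<le> M n" if "q \<in> cball p d" for n q using V(4) d(2) that by blast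
  qed
  with d show "\<exists>d>0. cball p d \<subseteq> W \<and> uniform_limit (cball p d) (\<lambda>n q. \<Sum>i<n. f i q) (\<lambda>q. \<Sum>n. f n q) sequentially"
    by auto
qed

lemma holomorphic_on_zeta_tail:
  assumes N: "N \<ge> 1"
  shows "zeta_tail N holomorphic_on {s. Re s > 0} - {1}"
proof -
  define W where "W = {s. Re s > 0} - {1::complex}"
  have W: "open W" unfolding W_def by (intro open_Diff open_halfspace_Re_gt) auto
  have "(\<lambda>s. \<Sum>j. em_diff (N + j) s) holomorphic_on W"
  proof (rule holomorphic_on_dominated_series[OF W])
    show "em_diff (N + n) holomorphic_on W" for n
      unfolding em_diff_def by (intro holomorphic_intros) (auto simp: W_def)
    fix p assume p: "p \<in> W"
    \<comment> \<open>On \<open>V\<close> both \<open>norm q\<close> and the exponent are controlled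
      by \<open>p\<close> alone, and half the real part of \<open>p\<close> still leaves an exponent
      below -1.\<close>
    define V where "V = {s. Re s > Re p / 2} \<inter> ball 0 (norm p + 1)"
    define M where "M = (\<lambda>j. (norm p + 1) * real (N + j) powr (- (Re p / 2 + 1)))"
    have "norm (em_diff (N + n) q) \<le> M n" if q: "q \<in> V \<inter> W" for q n
    proof -
      have "norm (em_diff (N + n) q) \<le> norm q * real (N + n) powr (- (Re q + 1))"
        using q N by (intro norm_em_diff_le) (auto simp: W_def)
      also have "\<dots> \<le> M n"
        unfolding M_def using q N by (intro mult_mono powr_mono) (auto simp: V_def)
      finally show ?thesis .
    qed
    moreover have "summable M"
      unfolding M_def using p N by (intro summable_mult powr_tail) (auto simp: W_def)
    moreover have "open V"
      unfolding V_def by (intro open_Int open_halfspace_Re_gt open_ball)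
    moreover have "p \<in> V"
      using p by (auto simp: V_def W_def)
    ultimately show "\<exists>V M. open V \<and> p \<in> V \<and> summable M \<and> (\<forall>q\<in>V \<inter> W. \<forall>n. norm (em_diff (N + n) q) \<le> M n)"
      by blast
  qed
  then have "(\<lambda>s. (\<Sum>j. em_diff (N + j) s) - of_nat N powr (1 - s) / (1 - s)) holomorphic_on W"
    by (intro holomorphic_intros) (auto simp: W_def)
  then show ?thesis by (simp add: W_def zeta_tail_def[abs_def])
qed

text \<open>As \<open>m\<close> counts from 0, the outer variable is \<open>Suc m\<close>; the inner
  sum runs over n >= 1, so its tail starts at \<open>Suc (Suc m)\<close>.\<close>

definition zeta2_term :: "nat \<Rightarrow> complex \<times> complex \<Rightarrow> complex" where
  "zeta2_term m = (\<lambda>(s1, s2). of_nat (Suc m) powr (- s1) * zeta_tail (Suc (Suc m)) s2)"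

text \<open>The exponent obtained lies below -1 exactly when \<open>Re (s1 + s2) > 2\<close>, which
  is what summation over \<open>m\<close> requires.\<close>

lemma norm_zeta2_term_le:
  assumes "Re s2 > 0" "s2 \<noteq> 1"
  shows "norm (zeta2_term m (s1, s2)) \<le>
    (norm s2 * (2 powr (Re s2 + 1) / Re s2) + 2 / norm (1 - s2)) * real (Suc m) powr (1 - Re (s1 + s2))"
proof -
  define n where "n = real (Suc m)"
  define \<sigma> where "\<sigma> = Re s2"
  define c where "c = norm s2 * (2 powr (\<sigma> + 1) / \<sigma>)"
  have c: "c \<ge> 0" using assms by (simp add: c_def \<sigma>_def)
  have n: "n \<ge> 1" by (simp add: n_def)
  have n1: "real (Suc (Suc m)) = n + 1" by (simp add: n_def)
  have p: "(n + 1) powr (- \<sigma>) \<le> n powr (- \<sigma>)"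
    using n assms by (intro powr_mono2') (auto simp: \<sigma>_def)
  have a: "n powr (- \<sigma>) \<le> n powr (1 - \<sigma>)" using n by (intro powr_mono) auto
  \<comment> \<open>The sign of 1 - \<sigma> is unknown, so a factor n + 1 <= 2 n is split off and
    only the negative power is compared.\<close>
  have b: "(n + 1) powr (1 - \<sigma>) \<le> 2 * n powr (1 - \<sigma>)"
  proof -
    have "(n + 1) powr (1 - \<sigma>) = (n + 1) * (n + 1) powr (- \<sigma>)"
      using n powr_add[of "n + 1" 1 "- \<sigma>"] by simp
    also have "\<dots> \<le> (2 * n) * n powr (- \<sigma>)" using n p by (intro mult_mono) auto
    also have "\<dots> = 2 * n powr (1 - \<sigma>)" using n powr_add[of n 1 "- \<sigma>"] by simp
    finally show ?thesis .
  qed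
  have "norm (zeta_tail (Suc (Suc m)) s2) \<le> norm s2 * (2 powr (\<sigma> + 1) / \<sigma> * (n + 1) powr (- \<sigma>)) + (n + 1) powr (1 - \<sigma>) / norm (1 - s2)"
    using norm_zeta_tail_le[of "Suc (Suc m)" s2] assms unfolding n1 \<sigma>_def by simp
  also have "\<dots> = c * (n + 1) powr (- \<sigma>) + (n + 1) powr (1 - \<sigma>) / norm (1 - s2)"
    by (simp add: c_def)
  also have "\<dots> \<le> c * n powr (1 - \<sigma>) + (2 * n powr (1 - \<sigma>)) / norm (1 - s2)"
    using p a b c by (intro add_mono mult_left_mono divide_right_mono) auto
  also have "\<dots> = (c + 2 / norm (1 - s2)) * n powr (1 - \<sigma>)"
    by (simp add: algebra_simps)
  finally have "n powr (- Re s1) * norm (zeta_tail (Suc (Suc m)) s2) \<le> n powr (- Re s1) * ((c + 2 / norm (1 - s2)) * n powr (1 - \<sigma>))"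
    by (intro mult_left_mono) auto
  also have "\<dots> = (c + 2 / norm (1 - s2)) * n powr (1 - Re (s1 + s2))"
    by (simp add: \<sigma>_def flip: powr_add) (simp add: algebra_simps)
  finally show ?thesis
    unfolding zeta2_term_def prod.case norm_mult norm_of_nat_powr by (simp add: n_def c_def \<sigma>_def)
qed

text \<open>The hypothesis \<open>\<sigma> > max 0 (2 - \<sigma>\<^sub>0)\<close> places the point
  of the theorem in this region. The only singular hyperplane that meets it is
  \<open>s2 = 1\<close>.\<close>

definition zeta2_dom :: "(complex \<times> complex) set" where
  "zeta2_dom = {(s1, s2). Re s2 > 0 \<and> Re (s1 + s2) > 2}"

lemma zeta2_dom_minus_sing: "zeta2_dom - zeta2_sing = {(s1, s2). Re s2 > 0 \<and> Re (s1 + s2) > 2 \<and> s2 \<noteq> 1}"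
proof -
  have "s1 + s2 \<notin> {2, 1} \<union> range (\<lambda>k::nat. - 2 * of_nat k)" if "Re (s1 + s2) > 2" for s1 s2 :: complex
  proof
    assume "s1 + s2 \<in> {2, 1} \<union> range (\<lambda>k::nat. - 2 * of_nat k)"
    then have "Re (s1 + s2) \<le> 2" by (auto simp del: plus_complex.sel)
    then show False using that by simp
  qed
  then show ?thesis unfolding zeta2_dom_def zeta2_sing_def by blast
qed

lemma zeta2_dom: "open zeta2_dom" "convex zeta2_dom"
proof -
  have eq: "zeta2_dom = (\<lambda>p. Re (snd p)) -` {0<..} \<inter> (\<lambda>p. Re (fst p + snd p)) -` {2<..}"
    by (auto simp: zeta2_dom_def)
  show "open zeta2_dom"
    unfolding eq by (intro open_Int open_vimage continuous_intros)
  show "convex zeta2_dom"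
    unfolding eq by (intro convex_Int convex_linear_vimage) (auto intro!: linearI simp: algebra_simps)
qed

lemma open_zeta2_dom_minus_sing: "open (zeta2_dom - zeta2_sing)"
proof -
  have "zeta2_dom - zeta2_sing = zeta2_dom \<inter> snd -` (- {1})"
    unfolding zeta2_dom_minus_sing by (auto simp: zeta2_dom_def)
  then show ?thesis
    by (auto intro!: open_Int zeta2_dom open_vimage_snd)
qed

lemma zeta2_term_locally_dominated:
  assumes "p \<in> zeta2_dom - zeta2_sing"
  shows "\<exists>V M. open V \<and> p \<in> V \<and> summable M \<and>
           (\<forall>q\<in>V \<inter> (zeta2_dom - zeta2_sing). \<forall>n. norm (zeta2_term n q) \<le> M n)"
proof -
  obtain p1 p2 where p: "p = (p1, p2)" by (cases p)
  with assms have P: "Re p2 > 0" "Re (p1 + p2) > 2" "p2 \<noteq> 1" by (auto simp: zeta2_dom_minus_sing)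
  define a \<delta> c R where "a = Re p2" and "\<delta> = norm (1 - p2)" and "c = Re (p1 + p2)" and "R = norm p2 + 1"
  have pos: "a > 0" "\<delta> > 0" "c > 2" "R > 0" using P by (auto simp: a_def \<delta>_def c_def R_def add_nonneg_pos)
  \<comment> \<open>These open conditions freeze the coefficient of the term bound to
    \<open>B\<close> and its exponent to 1 - (c + 2) / 2 = - c / 2, which is below -1 because c >
    2.\<close>
  define V where "V = (\<lambda>q. Re (snd q)) -` {a / 2<..<a + 1} \<inter> (\<lambda>q. norm (1 - snd q)) -` {\<delta> / 2<..}
      \<inter> (\<lambda>q. norm (snd q)) -` {..<R} \<inter> (\<lambda>q. Re (fst q + snd q)) -` {(c + 2) / 2<..}"
  define B where "B = R * (2 powr (a + 2) / (a / 2)) + 2 / (\<delta> / 2)"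
  define M where "M = (\<lambda>m. B * real (1 + m) powr (- (c / 2)))"
  have "open V" unfolding V_def by (intro open_Int open_vimage continuous_intros)
  moreover have "p \<in> V" using pos by (auto simp: V_def p a_def \<delta>_def c_def R_def)
  moreover have "summable M" unfolding M_def using pos by (intro summable_mult powr_tail) auto
  moreover have "norm (zeta2_term n q) \<le> M n" if "q \<in> V \<inter> (zeta2_dom - zeta2_sing)" for q n
  proof -
    obtain s1 s2 where q: "q = (s1, s2)" by (cases q)
    have s: "Re s2 > 0" "s2 \<noteq> 1" "a / 2 < Re s2" "Re s2 < a + 1" "\<delta> / 2 < norm (1 - s2)" "norm s2 < R" "Re (s1 + s2) > (c + 2) / 2"
      using that by (auto simp: q zeta2_dom_minus_sing V_def)
    have s': "norm s2 * (2 powr (Re s2 + 1) / Re s2) + 2 / norm (1 - s2) \<le> B"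
    proof -
      have "2 powr (Re s2 + 1) \<le> 2 powr (a + 2)" using s by (intro powr_mono) auto
      then have "2 powr (Re s2 + 1) / Re s2 \<le> 2 powr (a + 2) / (a / 2)"
        using s pos by (intro frac_le) auto
      moreover have "2 / norm (1 - s2) \<le> 2 / (\<delta> / 2)" using s pos by (intro frac_le) auto
      ultimately show ?thesis
        unfolding B_def using s pos by (intro add_mono mult_mono) auto
    qed
    have "norm (zeta2_term n q) \<le> (norm s2 * (2 powr (Re s2 + 1) / Re s2) + 2 / norm (1 - s2)) * real (Suc n) powr (1 - Re (s1 + s2))"
      unfolding q using s by (intro norm_zeta2_term_le)
    also have "\<dots> \<le> B * real (Suc n) powr (- (c / 2))"
      using s s' by (intro mult_mono powr_mono order.trans[OF _ s']) auto
    finally show ?thesis by (simp add: M_def)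
  qed
  ultimately show ?thesis by blast
qed

lemma summable_zeta2_term:
  assumes "p \<in> zeta2_dom - zeta2_sing"
  shows "summable (\<lambda>m. zeta2_term m p)"
proof -
  obtain V M where V: "open V" "p \<in> V" "summable M"
    "\<forall>q\<in>V \<inter> (zeta2_dom - zeta2_sing). \<forall>n. norm (zeta2_term n q) \<le> M n"
    using zeta2_term_locally_dominated[OF assms] by (elim exE conjE) (rule that)
  have "p \<in> V \<inter> (zeta2_dom - zeta2_sing)" using V(2) assms by (rule IntI)
  with V(4) have "norm (zeta2_term n p) \<le> M n" for n by blast
  then show ?thesis by (rule summable_comparison_test'[OF V(3)])
qed

text \<open>With \<open>euler_zeta2_eq\<close> this gives a concrete formula for
  \<open>euler_zeta2\<close> on the region. Local domination transfers continuity and holomorphy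
  from the terms, and for \<open>Re s2 > 1\<close> the continued tails are the original inner
  series.\<close>

lemma zeta2_continuation_zeta2_term: "zeta2_continuation zeta2_dom (\<lambda>p. \<Sum>m. zeta2_term m p)"
  unfolding zeta2_continuation_def
proof (intro conjI allI impI zeta2_dom)
  let ?W = "zeta2_dom - zeta2_sing"
  note W = open_zeta2_dom_minus_sing
  note zt = holomorphic_on_subset[OF holomorphic_on_zeta_tail]
  show "zeta2_conv \<subseteq> zeta2_dom" by (auto simp: zeta2_conv_def zeta2_dom_def)
  show "holomorphic2_on (\<lambda>p. \<Sum>m. zeta2_term m p) ?W"
    unfolding holomorphic2_on_def
  proof (intro conjI allI)
    have c: "continuous_on ?W (\<lambda>p. zeta_tail (Suc (Suc n)) (snd p))" for n
      by (rule continuous_on_compose2[OF holomorphic_on_imp_continuous_on[OF holomorphic_on_zeta_tail]])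
         (auto simp: zeta2_dom_minus_sing intro!: continuous_intros)
    show "continuous_on ?W (\<lambda>p. \<Sum>m. zeta2_term m p)"
    proof (rule continuous_on_dominated_series[OF W _ zeta2_term_locally_dominated])
      have "continuous_on ?W (\<lambda>p. exp (- fst p * ln (of_nat (Suc n))) * zeta_tail (Suc (Suc n)) (snd p))" for n
        by (intro continuous_intros c)
      then show "continuous_on ?W (zeta2_term n)" for n
        by (simp add: zeta2_term_def case_prod_unfold powr_def del: of_nat_Suc)
    qed
    \<comment> \<open>The same \<open>b\<close> is the fixed second coordinate in the first slice
      below and the fixed first coordinate in the second.\<close>
    fix b
    have oW: "open {z. (z, b) \<in> ?W}" "open {w. (b, w) \<in> ?W}"
    proof -
      have "open ((\<lambda>z. (z, b)) -` ?W)" "open ((\<lambda>w. (b, w)) -` ?W)"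
        by (intro open_vimage W continuous_intros)+
      then show "open {z. (z, b) \<in> ?W}" "open {w. (b, w) \<in> ?W}"
        by (simp_all only: vimage_def)
    qed
    show "(\<lambda>z. \<Sum>m. zeta2_term m (z, b)) holomorphic_on {z. (z, b) \<in> ?W}"
    proof (rule holomorphic_on_dominated_series[OF oW(1)])
      show "(\<lambda>z. zeta2_term n (z, b)) holomorphic_on {z. (z, b) \<in> ?W}" for n
        unfolding zeta2_term_def by (auto intro!: holomorphic_intros)
      fix p assume "p \<in> {z. (z, b) \<in> ?W}"
      with zeta2_term_locally_dominated[of "(p, b)"] obtain V M where "open V" "(p, b) \<in> V" "summable M"
        "\<forall>q\<in>V \<inter> ?W. \<forall>n. norm (zeta2_term n q) \<le> M n" by auto
      then show "\<exists>V M. open V \<and> p \<in> V \<and> summable M \<and> (\<forall>q\<in>V \<inter> {z. (z, b) \<in> ?W}. \<forall>n. norm (zeta2_term n (q, b)) \<le> M n)"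
        by (intro exI[of _ "(\<lambda>z. (z, b)) -` V"] exI[of _ M]) (auto intro!: open_vimage continuous_intros)
    qed
    show "(\<lambda>w. \<Sum>m. zeta2_term m (b, w)) holomorphic_on {w. (b, w) \<in> ?W}"
    proof (rule holomorphic_on_dominated_series[OF oW(2)])
      show "(\<lambda>w. zeta2_term n (b, w)) holomorphic_on {w. (b, w) \<in> ?W}" for n
        unfolding zeta2_term_def prod.case
        by (intro holomorphic_intros zt) (auto simp: zeta2_dom_minus_sing)
      fix p assume "p \<in> {w. (b, w) \<in> ?W}"
      with zeta2_term_locally_dominated[of "(b, p)"] obtain V M where "open V" "(b, p) \<in> V" "summable M"
        "\<forall>q\<in>V \<inter> ?W. \<forall>n. norm (zeta2_term n q) \<le> M n" by auto
      then show "\<exists>V M. open V \<and> p \<in> V \<and> summable M \<and> (\<forall>q\<in>V \<inter> {w. (b, w) \<in> ?W}. \<forall>n. norm (zeta2_term n (b, q)) \<le> M n)"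
        by (intro exI[of _ "(\<lambda>z. (b, z)) -` V"] exI[of _ M]) (auto intro!: open_vimage continuous_intros)
    qed
  qed
  fix s1 s2 assume "(s1, s2) \<in> zeta2_conv"
  then have "Re s2 > 1" by (simp add: zeta2_conv_def)
  then have "(\<Sum>n. of_nat (Suc m + Suc n) powr (- s2)) = zeta_tail (Suc (Suc m)) s2" for m
    using zeta_tail_sums[of "Suc (Suc m)" s2] by (simp add: sums_iff)
  then show "(\<Sum>m. zeta2_term m (s1, s2)) = zeta2_series s1 s2"
    unfolding zeta2_series_def zeta2_term_def by simp
qed

section \<open>Weighted sums\<close>

text \<open>For a <= 0 the terms increase and n times the last one suffices, with constant 1. For 0
  < a < 1 comparison with the integral gives \<open>1 / (1 - a)\<close>. The stated constant covers
  both.\<close>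

lemma sum_powr_le:
  fixes a :: real
  assumes "a < 1"
  shows "(\<Sum>m<n. real (Suc m) powr (- a)) \<le> (1 + 1 / (1 - a)) * real n powr (1 - a)"
proof (cases "a \<le> 0")
  case True
  have "(\<Sum>m<n. real (Suc m) powr (- a)) \<le> (\<Sum>m<n. real n powr (- a))"
    using True by (intro sum_mono powr_mono2) auto
  also have "\<dots> = real n powr (1 - a)"
    using powr_add[of "real n" 1 "- a"] by simp
  also have "\<dots> \<le> (1 + 1 / (1 - a)) * real n powr (1 - a)"
    using assms mult_right_mono[of 1 "1 + 1 / (1 - a)" "real n powr (1 - a)"] by simp
  finally show ?thesis .
next
  case False
  show ?thesis
  proof (induction n)
    case (Suc n)
    have "real (Suc n) powr (- a) \<le> (1 + 1 / (1 - a)) * (real (Suc n) powr (1 - a) - real n powr (1 - a))"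
    \<comment> \<open>The first term is checked directly, since for positive \<open>a\<close> the
      power \<open>1 - a\<close> need not be differentiable at 0.\<close>
    proof (cases "n = 0")
      case False
      have "\<exists>z. real n < z \<and> z < real (Suc n) \<and>
          real (Suc n) powr (1 - a) - real n powr (1 - a) = (real (Suc n) - real n) * ((1 - a) * z powr (- a))"
        using assms False by (intro MVT2) (auto intro!: derivative_eq_intros)
      then obtain z where z: "real n < z" "z < real (Suc n)"
        "real (Suc n) powr (1 - a) - real n powr (1 - a) = (1 - a) * z powr (- a)" by auto
      have "real (Suc n) powr (- a) \<le> z powr (- a)"
        using z \<open>\<not> a \<le> 0\<close> by (intro powr_mono2') auto
      also have "\<dots> = 1 / (1 - a) * ((1 - a) * z powr (- a))" using assms by simp
      also have "\<dots> \<le> (1 + 1 / (1 - a)) * ((1 - a) * z powr (- a))"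
        using assms by (intro mult_right_mono) auto
      finally show ?thesis unfolding z .
    qed (use assms in auto)
    with Suc show ?case by (simp add: algebra_simps)
  qed auto
qed

text \<open>The difference \<open>harm n - ln n\<close> decreases and equals 1 at n = 1.\<close>

lemma sum_inverse_le: "n \<ge> 1 \<Longrightarrow> (\<Sum>m<n. real (Suc m) powr (- 1)) \<le> 1 + ln (real n)"
proof -
  assume n: "n \<ge> 1"
  have "(\<Sum>m<n. real (Suc m) powr (- 1)) = harm n"
    unfolding harm_def by (rule sum.reindex_bij_witness[of _ "\<lambda>m. m - 1" Suc])
      (auto simp: powr_minus)
  also have "harm n - ln (real n) \<le> harm (Suc 0) - ln (real (Suc 0))"
    using decseqD[OF decseq_harm_diff_ln, of 0 "n - 1"] n by simp
  then have "harm n \<le> 1 + ln (real n)" by (simp add: harm_def)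
  finally show ?thesis .
qed

definition error_scale :: "real \<Rightarrow> real \<Rightarrow> real \<Rightarrow> real" where
  "error_scale \<sigma>\<^sub>0 \<sigma> x = (if \<sigma>\<^sub>0 > 1 then x powr (- \<sigma>)
                    else if \<sigma>\<^sub>0 = 1 then x powr (- \<sigma>) * ln x
                    else x powr (1 - \<sigma> - \<sigma>\<^sub>0))"

text \<open>The sum is split where the summation variable passes \<open>x\<close>: below,
  \<open>Suc m + x\<close> is replaced by \<open>x\<close>; above, by \<open>Suc m\<close>, leaving
  a convergent tail. The terms with index at least \<open>N\<close> have variable at least
  \<open>Suc N >= x\<close>.\<close>

lemma weighted_sum_split_le:
  fixes \<sigma>\<^sub>0 \<sigma> x :: real
  assumes \<sigma>: "\<sigma> > 0" "\<sigma>\<^sub>0 + \<sigma> > 2" and x: "x \<ge> 1"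
  defines "f \<equiv> \<lambda>m. real (Suc m) powr (- \<sigma>\<^sub>0) * (real (Suc m) + x) powr (- \<sigma>)"
  shows "summable f"
    and "suminf f \<le> x powr (- \<sigma>) * (\<Sum>m<nat \<lfloor>x\<rfloor>. real (Suc m) powr (- \<sigma>\<^sub>0)) +
           2 powr (\<sigma>\<^sub>0 + \<sigma>) / (\<sigma>\<^sub>0 + \<sigma> - 1) * x powr (1 - \<sigma> - \<sigma>\<^sub>0)"
proof -
  define N where "N = nat \<lfloor>x\<rfloor>"
  define \<tau> where "\<tau> = \<sigma>\<^sub>0 + \<sigma>"
  have \<tau>: "\<tau> > 1" using \<sigma> by (simp add: \<tau>_def)
  have N: "x \<le> real (Suc N)" using x unfolding N_def by linarith
  have f1: "f m \<le> real (1 + m) powr (- \<tau>)" for m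
  proof -
    have "f m \<le> real (Suc m) powr (- \<sigma>\<^sub>0) * real (Suc m) powr (- \<sigma>)"
      unfolding f_def using \<sigma> x by (intro mult_left_mono powr_mono2') auto
    also have "\<dots> = real (1 + m) powr (- \<tau>)" by (simp add: \<tau>_def flip: powr_add)
    finally show ?thesis .
  qed
  have f0: "f m \<ge> 0" for m by (simp add: f_def)
  show S: "summable f"
    by (rule summable_comparison_test'[OF powr_tail(1)[OF \<tau>, of 1], of 0]) (use f0 f1 in auto)
  have "(\<Sum>m<N. f m) \<le> (\<Sum>m<N. x powr (- \<sigma>) * real (Suc m) powr (- \<sigma>\<^sub>0))"
  proof (rule sum_mono)
    fix m
    have "(real (Suc m) + x) powr (- \<sigma>) \<le> x powr (- \<sigma>)"
      using \<sigma> x by (intro powr_mono2') auto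
    from mult_right_mono[OF this, of "real (Suc m) powr (- \<sigma>\<^sub>0)"]
    show "f m \<le> x powr (- \<sigma>) * real (Suc m) powr (- \<sigma>\<^sub>0)"
      by (simp add: f_def mult.commute)
  qed
  moreover have "(\<Sum>m. f (m + N)) \<le> 2 powr \<tau> / (\<tau> - 1) * x powr (1 - \<tau>)"
  proof -
    have "(\<Sum>m. f (m + N)) \<le> (\<Sum>m. real (Suc N + m) powr (- \<tau>))"
    proof (rule suminf_le)
      show "f (m + N) \<le> real (Suc N + m) powr (- \<tau>)" for m
        using f1[of "m + N"] by (simp add: algebra_simps)
      show "summable (\<lambda>m. f (m + N))" using S by (rule summable_ignore_initial_segment)
    qed (use powr_tail(1)[OF \<tau>, of "Suc N"] in auto)
    also have "\<dots> \<le> 2 powr \<tau> / (\<tau> - 1) * real (Suc N) powr (1 - \<tau>)"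
      by (rule powr_tail(2)[OF \<tau>]) auto
    also have "\<dots> \<le> 2 powr \<tau> / (\<tau> - 1) * x powr (1 - \<tau>)"
      using \<tau> N x by (intro mult_left_mono powr_mono2') auto
    finally show ?thesis .
  qed
  moreover have "suminf f = (\<Sum>m. f (m + N)) + (\<Sum>m<N. f m)"
    using S by (rule suminf_split_initial_segment)
  ultimately show "suminf f \<le> x powr (- \<sigma>) * (\<Sum>m<nat \<lfloor>x\<rfloor>. real (Suc m) powr (- \<sigma>\<^sub>0)) +
           2 powr (\<sigma>\<^sub>0 + \<sigma>) / (\<sigma>\<^sub>0 + \<sigma> - 1) * x powr (1 - \<sigma> - \<sigma>\<^sub>0)"
    by (simp add: N_def \<tau>_def sum_distrib_left algebra_simps)
qed

lemma weighted_sum_le: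
  fixes \<sigma>\<^sub>0 \<sigma> :: real
  assumes \<sigma>: "\<sigma> > 0" "\<sigma>\<^sub>0 + \<sigma> > 2"
  obtains K where "K \<ge> 0"
    "\<And>x. x \<ge> 3 \<Longrightarrow> (\<Sum>m. real (Suc m) powr (- \<sigma>\<^sub>0) * (real (Suc m) + x) powr (- \<sigma>)) \<le> K * error_scale \<sigma>\<^sub>0 \<sigma> x"
proof -
  define c where "c = 2 powr (\<sigma>\<^sub>0 + \<sigma>) / (\<sigma>\<^sub>0 + \<sigma> - 1)"
  have c: "c \<ge> 0" using \<sigma> by (simp add: c_def)
  have split: "(\<Sum>m. real (Suc m) powr (- \<sigma>\<^sub>0) * (real (Suc m) + x) powr (- \<sigma>))
      \<le> x powr (- \<sigma>) * S + c * x powr (1 - \<sigma> - \<sigma>\<^sub>0)"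
    if "x \<ge> 3" "(\<Sum>m<nat \<lfloor>x\<rfloor>. real (Suc m) powr (- \<sigma>\<^sub>0)) \<le> S" for x S
  proof -
    have "x powr (- \<sigma>) * (\<Sum>m<nat \<lfloor>x\<rfloor>. real (Suc m) powr (- \<sigma>\<^sub>0)) \<le> x powr (- \<sigma>) * S"
      using that by (intro mult_left_mono) auto
    then show ?thesis using weighted_sum_split_le(2)[OF \<sigma>, of x] that unfolding c_def by linarith
  qed
  consider "\<sigma>\<^sub>0 > 1" | "\<sigma>\<^sub>0 = 1" | "\<sigma>\<^sub>0 < 1" by linarith
  then show ?thesis
  proof cases
    case 1
    define Z where "Z = (\<Sum>m. real (1 + m) powr (- \<sigma>\<^sub>0))"
    have S: "summable (\<lambda>m. real (1 + m) powr (- \<sigma>\<^sub>0))" by (rule powr_tail(1)[OF 1]) auto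
    have Z: "(\<Sum>m<n. real (Suc m) powr (- \<sigma>\<^sub>0)) \<le> Z" for n
      using sum_le_suminf[OF S, of "{..<n}"] by (simp add: Z_def)
    have "Z \<ge> 0" using Z[of 0] by simp
    show ?thesis
    proof (rule that[of "Z + c"])
      fix x :: real assume x: "x \<ge> 3"
      have "c * x powr (1 - \<sigma> - \<sigma>\<^sub>0) \<le> c * x powr (- \<sigma>)"
        using 1 x c by (intro mult_left_mono powr_mono) auto
      then show "(\<Sum>m. real (Suc m) powr (- \<sigma>\<^sub>0) * (real (Suc m) + x) powr (- \<sigma>)) \<le> (Z + c) * error_scale \<sigma>\<^sub>0 \<sigma> x"
        using split[OF x Z] 1 by (simp add: error_scale_def algebra_simps)
    qed (use \<open>Z \<ge> 0\<close> c in auto)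
  next
    case 2
    show ?thesis
    proof (rule that[of "2 + c"])
      fix x :: real assume x: "x \<ge> 3"
      \<comment> \<open>The range x >= 3 > e makes ln x at least 1, so that both constant
        contributions are absorbed into the logarithm.\<close>
      have "exp 1 \<le> x" using exp_le x by linarith
      then have l: "ln x \<ge> 1" using x by (simp add: ln_ge_iff)
      have n: "nat \<lfloor>x\<rfloor> \<ge> 1" "real (nat \<lfloor>x\<rfloor>) \<le> x" using x by linarith+
      have "ln (real (nat \<lfloor>x\<rfloor>)) \<le> ln x" using n by (subst ln_le_cancel_iff) auto
      then have "(\<Sum>m<nat \<lfloor>x\<rfloor>. real (Suc m) powr (- \<sigma>\<^sub>0)) \<le> 2 * ln x"
        using sum_inverse_le[OF n(1)] l 2 by simp
      note split[OF x this]
      moreover have "c * x powr (- \<sigma>) * 1 \<le> c * x powr (- \<sigma>) * ln x"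
        using c l by (intro mult_left_mono) auto
      ultimately show "(\<Sum>m. real (Suc m) powr (- \<sigma>\<^sub>0) * (real (Suc m) + x) powr (- \<sigma>)) \<le> (2 + c) * error_scale \<sigma>\<^sub>0 \<sigma> x"
        using 2 by (simp add: error_scale_def algebra_simps)
    qed (use c in auto)
  next
    case 3
    define d where "d = 1 + 1 / (1 - \<sigma>\<^sub>0)"
    have d: "d \<ge> 0" using 3 by (simp add: d_def)
    show ?thesis
    proof (rule that[of "d + c"])
      fix x :: real assume x: "x \<ge> 3"
      \<comment> \<open>Here both parts of the split have the same order
        \<open>x powr (1 - \<sigma> - \<sigma>\<^sub>0)\<close>.\<close>
      have "(\<Sum>m<nat \<lfloor>x\<rfloor>. real (Suc m) powr (- \<sigma>\<^sub>0)) \<le> d * real (nat \<lfloor>x\<rfloor>) powr (1 - \<sigma>\<^sub>0)"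
        unfolding d_def by (rule sum_powr_le[OF 3])
      also have "\<dots> \<le> d * x powr (1 - \<sigma>\<^sub>0)"
        using d x 3 by (intro mult_left_mono powr_mono2) auto
      finally have "(\<Sum>m. real (Suc m) powr (- \<sigma>\<^sub>0) * (real (Suc m) + x) powr (- \<sigma>))
          \<le> x powr (- \<sigma>) * (d * x powr (1 - \<sigma>\<^sub>0)) + c * x powr (1 - \<sigma> - \<sigma>\<^sub>0)"
        by (rule split[OF x])
      also have "x powr (- \<sigma>) * (d * x powr (1 - \<sigma>\<^sub>0)) = d * x powr (1 - \<sigma> - \<sigma>\<^sub>0)"
        by (simp flip: powr_add) (simp add: algebra_simps)
      finally show "(\<Sum>m. real (Suc m) powr (- \<sigma>\<^sub>0) * (real (Suc m) + x) powr (- \<sigma>)) \<le> (d + c) * error_scale \<sigma>\<^sub>0 \<sigma> x"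
        using 3 by (simp add: error_scale_def algebra_simps)
    qed (use c d in auto)
  qed
qed

section \<open>Main terms and the asymptotic formula\<close>

lemma summable_main_terms:
  fixes s\<^sub>0 s :: complex and x :: real
  assumes s: "Re s > 0" "Re (s\<^sub>0 + s) > 2" and x: "x \<ge> 1"
  shows "summable (\<lambda>m. \<Sum>n = 1..N. of_nat (Suc m) powr (- s\<^sub>0) * of_nat (Suc m + n) powr (- s))" (is "summable ?f")
    and "summable (\<lambda>m. of_nat (Suc m) powr (- s\<^sub>0) * of_real (real (Suc m) + x) powr (1 - s))" (is "summable ?g")
proof -
  define \<tau> where "\<tau> = Re (s\<^sub>0 + s)"
  have \<tau>: "\<tau> > 2" using s by (simp add: \<tau>_def)
  have pw: "real (Suc m) powr (- Re s\<^sub>0) * y powr (- Re s) \<le> real (1 + m) powr (- \<tau>)"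
    if "y \<ge> real (Suc m)" for m y
  proof -
    have "real (Suc m) powr (- Re s\<^sub>0) * y powr (- Re s) \<le> real (Suc m) powr (- Re s\<^sub>0) * real (Suc m) powr (- Re s)"
      using that s by (intro mult_left_mono powr_mono2') auto
    also have "\<dots> = real (1 + m) powr (- \<tau>)" by (simp add: \<tau>_def flip: powr_add)
    finally show ?thesis .
  qed
  show "summable ?f"
  proof (rule summable_sum, rule summable_comparison_test'[OF powr_tail(1)[of \<tau> 1]])
    show "norm (of_nat (Suc m) powr (- s\<^sub>0) * of_nat (Suc m + n) powr (- s)) \<le> real (1 + m) powr (- \<tau>)" for m n
      unfolding norm_mult norm_of_nat_powr using pw[of m "real (Suc m + n)"] by simp
  qed (use \<tau> in auto)
  show "summable ?g"
  proof (rule summable_comparison_test'[OF summable_mult[where c = "1 + x", OF powr_tail(1)[of "\<tau> - 1" 1]]])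
    fix m :: nat
    have "norm (of_nat (Suc m) powr (- s\<^sub>0) * of_real (real (Suc m) + x) powr (1 - s))
        = real (Suc m) powr (- Re s\<^sub>0) * (real (Suc m) + x) powr (1 - Re s)"
      unfolding norm_mult norm_of_nat_powr using x by (subst norm_of_real_powr) auto
    \<comment> \<open>Splitting off one factor leaves a negative power whatever the sign of
      \<open>1 - Re s\<close>. The factor is at most \<open>(1 + x) * Suc m\<close>, so the exponent
      becomes \<open>- (\<tau> - 1)\<close>, still below -1 because \<tau> > 2.\<close>
    also have "(real (Suc m) + x) powr (1 - Re s) = (real (Suc m) + x) * (real (Suc m) + x) powr (- Re s)"
      using x powr_add[of "real (Suc m) + x" 1 "- Re s"] by simp
    also have "real (Suc m) powr (- Re s\<^sub>0) * ((real (Suc m) + x) * (real (Suc m) + x) powr (- Re s))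
        = (real (Suc m) + x) * (real (Suc m) powr (- Re s\<^sub>0) * (real (Suc m) + x) powr (- Re s))"
      by simp
    also have "\<dots> \<le> ((1 + x) * real (1 + m)) * real (1 + m) powr (- \<tau>)"
    proof (intro mult_mono pw)
      have "x * 1 \<le> x * real (Suc m)" using x by (intro mult_left_mono) auto
      then show "real (Suc m) + x \<le> (1 + x) * real (1 + m)" by (simp add: algebra_simps)
    qed (use x in auto)
    also have "\<dots> = (1 + x) * real (1 + m) powr (- (\<tau> - 1))"
      using powr_add[of "real (1 + m)" 1 "- \<tau>"] by simp
    finally show "norm (of_nat (Suc m) powr (- s\<^sub>0) * of_real (real (Suc m) + x) powr (1 - s))
      \<le> (1 + x) * real (1 + m) powr (- (\<tau> - 1))" .
  qed (use \<tau> in auto)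
qed

text \<open>The quantifier order lets the constants depend only on \<open>C\<close>,
  \<open>\<sigma>\<^sub>0\<close> and \<open>\<sigma>\<close>: the estimate is uniform in both
  imaginary parts, subject to the bound on that of \<open>s\<close>.\<close>

theorem theorem3p1:
  fixes \<sigma>\<^sub>0 \<sigma> C :: real
  assumes "C > 1" and "\<sigma> > max 0 (2 - \<sigma>\<^sub>0)"
  shows "\<exists>K. \<exists>X\<ge>1. \<forall>x\<ge>X. \<forall>s\<^sub>0 s :: complex.
           Re s\<^sub>0 = \<sigma>\<^sub>0 \<longrightarrow> Re s = \<sigma> \<longrightarrow> s \<noteq> 1 \<longrightarrow> \<bar>Im s\<bar> \<le> 2 * pi * x / C \<longrightarrow>
           norm (euler_zeta2 s\<^sub>0 s -
                 ((\<Sum>m. \<Sum>n = 1..nat \<lfloor>x\<rfloor>.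
                     1 / (of_nat (Suc m) powr s\<^sub>0 * of_nat (Suc m + n) powr s)) -
                  1 / (1 - s) *
                    (\<Sum>m. 1 / (of_nat (Suc m) powr s\<^sub>0 *
                              (of_nat (Suc m) + of_real x) powr (s - 1)))))
             \<le> K * (if \<sigma>\<^sub>0 > 1 then x powr (- \<sigma>)
                    else if \<sigma>\<^sub>0 = 1 then x powr (- \<sigma>) * ln x
                    else x powr (1 - \<sigma> - \<sigma>\<^sub>0))"
proof -
  have \<sigma>: "\<sigma> > 0" "\<sigma>\<^sub>0 + \<sigma> > 2" using assms(2) by auto
  obtain K1 where K1: "K1 \<ge> 0" and approx:
    "\<And>P y s. Re s = \<sigma> \<Longrightarrow> s \<noteq> 1 \<Longrightarrow> y > 0 \<Longrightarrow> y \<le> real P \<Longrightarrow> real P \<le> y + 1 \<Longrightarrow>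
       \<bar>Im s\<bar> \<le> 2 * pi * y / C \<Longrightarrow>
       norm (zeta_tail P s + of_real y powr (1 - s) / (1 - s)) \<le> K1 * y powr (- \<sigma>)"
    by (rule zeta_tail_approx[OF assms(1) \<sigma>(1)]) (rule that)
  obtain K2 where K2: "K2 \<ge> 0" and weights:
    "\<And>x. x \<ge> 3 \<Longrightarrow> (\<Sum>m. real (Suc m) powr (- \<sigma>\<^sub>0) * (real (Suc m) + x) powr (- \<sigma>)) \<le> K2 * error_scale \<sigma>\<^sub>0 \<sigma> x"
    by (rule weighted_sum_le[OF \<sigma>]) (rule that)
  show ?thesis
  proof (rule exI[of _ "K1 * K2"], rule exI[of _ 3], intro conjI allI impI)
    fix x :: real and s\<^sub>0 s :: complex
    assume x: "x \<ge> 3" and s: "Re s\<^sub>0 = \<sigma>\<^sub>0" "Re s = \<sigma>" "s \<noteq> 1" and t: "\<bar>Im s\<bar> \<le> 2 * pi * x / C"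
    define N where "N = nat \<lfloor>x\<rfloor>"
    have N: "real N \<le> x" "x \<le> real N + 1" using x unfolding N_def by linarith+
    have dom: "(s\<^sub>0, s) \<in> zeta2_dom - zeta2_sing"
      using s \<sigma> by (simp add: zeta2_dom_minus_sing)
    define T where "T = (\<lambda>m. of_nat (Suc m) powr (- s\<^sub>0) * zeta_tail (Suc (Suc m)) s)"
    define f where "f = (\<lambda>m. \<Sum>n = 1..N. of_nat (Suc m) powr (- s\<^sub>0) * of_nat (Suc m + n) powr (- s))"
    define g where "g = (\<lambda>m. of_nat (Suc m) powr (- s\<^sub>0) * of_real (real (Suc m) + x) powr (1 - s))"
    have sf: "summable f" and sg: "summable g"
      unfolding f_def g_def using summable_main_terms[of s s\<^sub>0 x] s \<sigma> x by simp_all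
    have sT: "summable T" "euler_zeta2 s\<^sub>0 s = suminf T"
      using summable_zeta2_term[OF dom] euler_zeta2_eq[OF zeta2_continuation_zeta2_term dom]
      by (simp_all add: T_def zeta2_term_def)
    \<comment> \<open>The whole error is the sum over \<open>m\<close> of the errors
      \<open>e m\<close> made by truncating each inner tail.\<close>
    define e where "e = (\<lambda>m. T m - f m + g m / (1 - s))"
    have "e sums (suminf T - suminf f + suminf g / (1 - s))"
      unfolding e_def by (intro sums_add sums_diff sums_divide summable_sums sT sf sg)
    then have e: "suminf e = suminf T - suminf f + suminf g / (1 - s)" by (simp add: sums_iff)
    have eb: "norm (e m) \<le> K1 * (real (Suc m) powr (- \<sigma>\<^sub>0) * (real (Suc m) + x) powr (- \<sigma>))" for m
    proof -
      \<comment> \<open>After \<open>N\<close> terms the tail restarts at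
        \<open>Suc (Suc m) + N\<close>, which lies between \<open>y\<close> and \<open>y + 1\<close>
        because N <= x <= N + 1. As y >= x, the bound on \<open>Im s\<close> in terms of
        \<open>x\<close> also holds in terms of \<open>y\<close>.\<close>
      define y where "y = real (Suc m) + x"
      have "(\<Sum>j<N. of_nat (Suc (Suc m) + j) powr (- s)) = (\<Sum>n = 1..N. of_nat (Suc m + n) powr (- s))"
        by (rule sum.reindex_bij_witness[of _ "\<lambda>m. m - 1" Suc]) auto
      with zeta_tail_shift[of "Suc (Suc m)" s N] s \<sigma>
      have "zeta_tail (Suc (Suc m)) s = (\<Sum>n = 1..N. of_nat (Suc m + n) powr (- s)) + zeta_tail (Suc (Suc m) + N) s"
        by simp
      then have "e m = of_nat (Suc m) powr (- s\<^sub>0) * (zeta_tail (Suc (Suc m) + N) s + of_real y powr (1 - s) / (1 - s))"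
        unfolding e_def T_def f_def g_def y_def sum_distrib_left[symmetric]
        by (simp add: algebra_simps del: of_nat_Suc)
      then have "norm (e m) = real (Suc m) powr (- \<sigma>\<^sub>0) * norm (zeta_tail (Suc (Suc m) + N) s + of_real y powr (1 - s) / (1 - s))"
        by (simp only: norm_mult norm_of_nat_powr) (simp add: s)
      also have "\<dots> \<le> real (Suc m) powr (- \<sigma>\<^sub>0) * (K1 * y powr (- \<sigma>))"
      proof (intro mult_left_mono approx s)
        have "2 * pi * x / C \<le> 2 * pi * y / C"
          using assms(1) by (intro divide_right_mono mult_left_mono) (auto simp: y_def)
        then show "\<bar>Im s\<bar> \<le> 2 * pi * y / C" using t by linarith
      qed (use N x in \<open>auto simp: y_def\<close>)
      finally show ?thesis by (simp add: y_def algebra_simps)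
    qed
    have sw: "summable (\<lambda>m. real (Suc m) powr (- \<sigma>\<^sub>0) * (real (Suc m) + x) powr (- \<sigma>))"
      using weighted_sum_split_le(1)[OF \<sigma>] x by simp
    have "norm (suminf e) \<le> (\<Sum>m. K1 * (real (Suc m) powr (- \<sigma>\<^sub>0) * (real (Suc m) + x) powr (- \<sigma>)))"
      by (intro norm_suminf_le eb summable_mult sw)
    also have "\<dots> = K1 * (\<Sum>m. real (Suc m) powr (- \<sigma>\<^sub>0) * (real (Suc m) + x) powr (- \<sigma>))"
      by (intro suminf_mult sw)
    also have "\<dots> \<le> K1 * (K2 * error_scale \<sigma>\<^sub>0 \<sigma> x)"
      by (intro mult_left_mono weights x K1)
    finally have fin: "norm (suminf e) \<le> K1 * K2 * error_scale \<sigma>\<^sub>0 \<sigma> x" by simp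
    have f': "(\<lambda>m. \<Sum>n = 1..nat \<lfloor>x\<rfloor>. 1 / (of_nat (Suc m) powr s\<^sub>0 * of_nat (Suc m + n) powr s)) = f"
      by (simp add: f_def N_def powr_minus_divide del: of_nat_Suc of_nat_add)
    have g': "(\<lambda>m. 1 / (of_nat (Suc m) powr s\<^sub>0 * (of_nat (Suc m) + of_real x) powr (s - 1))) = g"
    proof
      fix m
      show "1 / (of_nat (Suc m) powr s\<^sub>0 * (of_nat (Suc m) + of_real x) powr (s - 1)) = g m"
        using powr_minus_divide[of "of_nat (Suc m) + complex_of_real x" "s - 1"]
        by (simp add: g_def powr_minus_divide[of _ s\<^sub>0] del: of_nat_Suc)
    qed
    show "norm (euler_zeta2 s\<^sub>0 s -
                 ((\<Sum>m. \<Sum>n = 1..nat \<lfloor>x\<rfloor>.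
                     1 / (of_nat (Suc m) powr s\<^sub>0 * of_nat (Suc m + n) powr s)) -
                  1 / (1 - s) *
                    (\<Sum>m. 1 / (of_nat (Suc m) powr s\<^sub>0 *
                              (of_nat (Suc m) + of_real x) powr (s - 1)))))
             \<le> K1 * K2 * (if \<sigma>\<^sub>0 > 1 then x powr (- \<sigma>)
                    else if \<sigma>\<^sub>0 = 1 then x powr (- \<sigma>) * ln x
                    else x powr (1 - \<sigma> - \<sigma>\<^sub>0))"
      unfolding f' g' sT(2) error_scale_def[symmetric] using fin unfolding e by (simp add: algebra_simps)
  qed auto
qed

end
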